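(* There is an $m_0$ such that for every integer $m\ge m_0$ and every $\mathcal{A}\in\mathscr{A}_m$ we have $|\mathcal{A}|\le\sqrt{191m}$.
   Context: For a positive integer $m$ let $\mathbb{Z}_m=\mathbb{Z}/m\mathbb{Z}$. For $\mathcal{A}\subseteq \mathbb{Z}_m$ and $n\in\mathbb{Z}_m$ put $\sigma_{\mathcal{A}}(n)=\#\{(a,a')\in\mathcal{A}^2: a+a'\equiv n \pmod m\}$ (ordered pairs). The Ruzsa number $R_m$ is the least integer $r$ such that there is a subset $\mathcal{A}\subseteq\mathbb{Z}_m$ with $1\le \sigma_{\mathcal{A}}(n)\le r$ for all $n\in\mathbb{Z}_m$. $\mathscr{A}_m$ denotes the set of all subsets $\mathcal{A}\subseteq[0,m-1]$ of integers (identified with subsets of $\mathbb{Z}_m$) such that $1\le\sigma_{\mathcal{A}}(n)\le R_m$ for all $n\in\mathbb{Z}_m$. *)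

theory Defs
  imports Complex_Main "HOL-Number_Theory.Cong"
begin

text \<open>
  A subset of \<open>\<int>/m\<int>\<close> (for \<open>m > 0\<close>) is represented by its set of representatives
  \<open>A \<subseteq> {0..<int m}\<close>, and a residue class by any integer \<open>n\<close> in it; \<open>rep_count m A n\<close>
  depends on \<open>n\<close> only modulo \<open>m\<close>.
\<close>

definition rep_count :: "nat \<Rightarrow> int set \<Rightarrow> int \<Rightarrow> nat" where
  "rep_count m A n = card {(a, a') \<in> A \<times> A. [a + a' = n] (mod int m)}"

definition ruzsa_bounded :: "nat \<Rightarrow> nat \<Rightarrow> int set \<Rightarrow> bool" where
  "ruzsa_bounded m r A \<longleftrightarrow>
     A \<subseteq> {0..<int m} \<and> (\<forall>n. 1 \<le> rep_count m A n \<and> rep_count m A n \<le> r)"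

text \<open>
  For \<open>m > 0\<close> the minimum is attained: \<open>A = {0..<int m}\<close> has \<open>rep_count m A n = m\<close> for all \<open>n\<close>.
\<close>

definition ruzsa_number :: "nat \<Rightarrow> nat" where
  "ruzsa_number m = (LEAST r. \<exists>A. ruzsa_bounded m r A)"

definition ruzsa_sets :: "nat \<Rightarrow> int set set" where
  "ruzsa_sets m = {A. ruzsa_bounded m (ruzsa_number m) A}"

end

theory Submission
  imports "HOL-Real_Asymp.Real_Asymp" "HOL-Analysis.Convex" Defs
    "HOL-Number_Theory.Prime_Powers" "HOL-Number_Theory.Euler_Criterion"
begin

text \<open>
  Two facts are combined: \<open>R\<^sub>m \<le> 192\<close> for large \<open>m\<close>, and an energy estimate showing that \<open>\<sigma>\<close> cannot
  be nearly constant.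

  If \<open>1 \<le> \<sigma> \<le> 192\<close> with mean \<open>\<lambda> = |A|\<^sup>2 / m\<close>, then \<open>(\<sigma> - 1) (192 - \<sigma>) \<ge> 0\<close> bounds the mean
  of \<open>\<sigma>\<^sup>2\<close> by \<open>193 \<lambda> - 192\<close>. The sum of \<open>\<sigma>\<^sup>2\<close> is also the sum of squares of the number of
  representations as a difference; the difference \<open>0\<close> contributes \<open>|A|\<^sup>2\<close> and the other ones, by
  Cauchy-Schwarz, about \<open>|A|\<^sup>4 / m\<close>. Hence \<open>\<lambda>\<^sup>2 - 192 \<lambda> + 192 \<le> o(1)\<close>, which fails on \<open>[191, 192]\<close>.

  For the upper bound on \<open>R\<^sub>m\<close>, let \<open>p\<close> be prime and \<open>s\<close> a nonresidue modulo \<open>p\<close>. Every point \<open>(a, b)\<close> of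
  \<open>(\<int>/p)\<^sup>2\<close> is a sum of two points of the parabola \<open>v = 2s u\<^sup>2\<close>, or a sum of a point of \<open>v = s(s+1) u\<^sup>2\<close> and
  a point of \<open>v = (s+1) u\<^sup>2\<close>: the two discriminants are \<open>s D\<close> and \<open>D\<close> up to squares, with
  \<open>D = b - s a\<^sup>2\<close>. Any two of the three parabolas give at most two representations. The point \<open>(u, v)\<close> is placed at the
  integer \<open>u + 2 p v\<close>, and each parabola is translated by a few vectors \<open>p r + 2 p\<^sup>2 t\<close> to
  absorb the carries. The bound 192 holds whenever \<open>8 p\<^sup>2 / 3 < m \<le> 4 p\<^sup>2\<close> (up to lower order terms), so
  \<open>p\<close> may vary by a factor \<open>sqrt (3 / 2) > 6 / 5\<close>, which is the gap in Chebyshev's estimates.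
\<close>

subsection \<open>Primes between \<open>M\<close> and \<open>1.22 M\<close>\<close>

definition chebyshev_psi :: "nat \<Rightarrow> real" where
  "chebyshev_psi N = (\<Sum>d=1..N. mangoldt d)"

lemma chebyshev_psi_mono: "M \<le> N \<Longrightarrow> chebyshev_psi M \<le> chebyshev_psi N"
  unfolding chebyshev_psi_def by (rule sum_mono2) (auto simp: mangoldt_nonneg)

lemma Suc_div_eq_if_dvd: "Suc n div d = n div d + (if d dvd Suc n then 1 else 0)" if "d > 0"
  using that by (auto simp: div_Suc dvd_eq_mod_eq_0)

text \<open>Legendre's formula in logarithmic form. Passing from \<open>N\<close> to
  \<open>Suc N\<close> raises \<open>N div d\<close> by one exactly when \<open>d\<close> divides
  \<open>Suc N\<close>, and \<open>mangoldt\<close> summed over these \<open>d\<close> is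
  \<open>ln (Suc N)\<close>.\<close>

lemma ln_fact_eq_sum_mangoldt: "ln (fact N) = (\<Sum>d=1..N. mangoldt d * real (N div d))"
proof (induction N)
  case 0
  then show ?case by simp
next
  case (Suc N)
  have "(\<Sum>d=1..Suc N. mangoldt d * real (Suc N div d))
      = (\<Sum>d=1..Suc N. mangoldt d * real (N div d) + (if d dvd Suc N then mangoldt d else 0))"
    by (rule sum.cong) (auto simp: Suc_div_eq_if_dvd algebra_simps)
  also have "\<dots> = (\<Sum>d=1..Suc N. mangoldt d * real (N div d))
      + (\<Sum>d=1..Suc N. if d dvd Suc N then mangoldt d else 0)"
    by (rule sum.distrib)
  also have "(\<Sum>d=1..Suc N. if d dvd Suc N then mangoldt d else 0)
      = (\<Sum>d | d dvd Suc N. mangoldt d :: real)"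
    by (rule sum.mono_neutral_cong_right)
       (auto dest: dvd_imp_le intro!: Nat.gr0I simp: Suc_le_eq)
  also have "\<dots> = ln (real (Suc N))"
    using mangoldt_sum[of "Suc N", where ?'a = real] by simp
  finally show ?case
    using Suc by (simp add: ln_mult)
qed

text \<open>The terms with \<open>d\<close> above \<open>N div j\<close> vanish, so all the
  factorials of the combination become sums over one common range.\<close>

lemma ln_fact_div_eq_sum_mangoldt:
  assumes "j > 0"
  shows "ln (fact (N div j)) = (\<Sum>d=1..N. mangoldt d * real (N div d div j))"
proof -
  have "ln (fact (N div j)) = (\<Sum>d=1..N div j. mangoldt d * real (N div d div j))"
    by (simp add: ln_fact_eq_sum_mangoldt div_mult2_eq [symmetric] mult.commute)
  also have "\<dots> = (\<Sum>d=1..N. mangoldt d * real (N div d div j))"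
  proof (rule sum.mono_neutral_left)
    show "\<forall>i\<in>{1..N} - {1..N div j}. mangoldt i * real (N div i div j) = 0"
    proof
      fix i assume "i \<in> {1..N} - {1..N div j}"
      hence "N div j < i" by auto
      hence "N div i div j = 0"
        by (simp add: div_mult2_eq [symmetric] mult.commute[of i])
           (simp add: div_mult2_eq)
      thus "mangoldt i * real (N div i div j) = 0" by simp
    qed
  qed (auto intro: div_le_dividend le_trans)
  finally show ?thesis .
qed

text \<open>
  Chebyshev's combination: the coefficient of \<open>mangoldt d\<close> in it depends only on \<open>N div d\<close>, lies in
  \<open>[0, 1]\<close>, and equals \<open>1\<close> for \<open>N div 6 < d \<le> N\<close>.
\<close>

definition chebyshev_sum :: "nat \<Rightarrow> real" where
  "chebyshev_sum N = ln (fact N) - ln (fact (N div 2)) - ln (fact (N div 3))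
     - ln (fact (N div 5)) + ln (fact (N div 30))"

text \<open>The slope of \<open>chebyshev_sum\<close>, about 0.921: as 1 - 1/2 - 1/3 - 1/5 + 1/30 =
  0, the terms N ln N and N of Stirling's formula cancel and this multiple of N remains.\<close>

definition chebyshev_const :: real where
  "chebyshev_const = ln 2 / 2 + ln 3 / 3 + ln 5 / 5 - ln 30 / 30"

text \<open>The same vanishing sum of reciprocals makes the coefficient depend only on
  \<open>q mod 30\<close>, which leaves thirty cases to evaluate.\<close>

lemma chebyshev_coeff:
  fixes q :: nat
  defines "c \<equiv> real q - real (q div 2) - real (q div 3) - real (q div 5) + real (q div 30)"
  shows "0 \<le> c" "c \<le> 1" "0 < q \<Longrightarrow> q < 6 \<Longrightarrow> c = 1"
proof -
  define t where "t = q div 30"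
  define r where "r = q mod 30"
  have q: "q = 30 * t + r" and r: "r < 30" unfolding t_def r_def by auto
  have d: "q div 2 = 15 * t + r div 2" "q div 3 = 10 * t + r div 3" "q div 5 = 6 * t + r div 5"
      "q div 30 = t"
    using r unfolding q by auto
  have c: "c = real r - real (r div 2) - real (r div 3) - real (r div 5)"
    unfolding c_def d unfolding q by simp
  have "r \<in> {..<30}" using r by simp
  thus "0 \<le> c" "c \<le> 1"
    unfolding c by (auto simp: lessThan_nat_numeral simp del: lessThan_iff)
  assume "0 < q" "q < 6"
  hence "q \<in> {1,2,3,4,5}" by auto
  thus "c = 1" unfolding c_def by auto
qed

lemma chebyshev_sum_eq:
  "chebyshev_sum N = (\<Sum>d=1..N. mangoldt d * (real (N div d) - real (N div d div 2)
     - real (N div d div 3) - real (N div d div 5) + real (N div d div 30)))"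
  unfolding chebyshev_sum_def
  by (simp add: ln_fact_div_eq_sum_mangoldt ln_fact_eq_sum_mangoldt[of N]
      sum.distrib sum_subtractf algebra_simps)

lemma chebyshev_sum_le_chebyshev_psi: "chebyshev_sum N \<le> chebyshev_psi N"
  unfolding chebyshev_sum_eq chebyshev_psi_def
proof (rule sum_mono)
  fix d
  show "mangoldt d * (real (N div d) - real (N div d div 2)
     - real (N div d div 3) - real (N div d div 5) + real (N div d div 30)) \<le> mangoldt d"
    using chebyshev_coeff(2)[of "N div d"] mangoldt_nonneg[of d] by (rule mult_left_le)
qed

lemma chebyshev_psi_le_chebyshev_sum: "chebyshev_psi N \<le> chebyshev_psi (N div 6) + chebyshev_sum N"
proof -
  define c where "c = (\<lambda>d. real (N div d) - real (N div d div 2)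
     - real (N div d div 3) - real (N div d div 5) + real (N div d div 30))"
  have "chebyshev_psi N = (\<Sum>d\<in>{1..N div 6} \<union> {N div 6 + 1..N}. mangoldt d)"
    unfolding chebyshev_psi_def by (rule sum.cong) auto
  also have "\<dots> = chebyshev_psi (N div 6) + (\<Sum>d=N div 6 + 1..N. mangoldt d)"
    unfolding chebyshev_psi_def by (rule sum.union_disjoint) auto
  also have "(\<Sum>d=N div 6 + 1..N. mangoldt d) = (\<Sum>d=N div 6 + 1..N. mangoldt d * c d)"
  proof (rule sum.cong)
    fix d assume d: "d \<in> {N div 6 + 1..N}"
    hence "N div d > 0" by (simp add: div_greater_zero_iff)
    moreover have "N div d < 6"
      using d by (auto simp: div_less_iff_less_mult)
    ultimately show "mangoldt d = mangoldt d * c d"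
      using chebyshev_coeff(3)[of "N div d"] unfolding c_def by simp
  qed simp
  also have "\<dots> \<le> (\<Sum>d=1..N. mangoldt d * c d)"
    using chebyshev_coeff(1) mangoldt_nonneg unfolding c_def
    by (intro sum_mono2) auto
  also have "\<dots> = chebyshev_sum N"
    unfolding chebyshev_sum_eq c_def ..
  finally show ?thesis by simp
qed

section \<open>Stirling bounds and the size of Chebyshev's combination\<close>

lemma ln_fact_Suc: "ln (fact (Suc n) :: real) = ln (real (Suc n)) + ln (fact n)"
  unfolding fact_Suc by (rule ln_mult_pos) auto

lemma ln_fact_lower: "real n * ln (real n) - real n \<le> ln (fact n)"
proof (induction n)
  case (Suc n)
  show ?case
  proof (cases "n = 0")
    case False
    have "real n * (ln (real (Suc n)) - ln (real n)) = real n * ln (1 + 1 / real n)"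
    proof -
      have "1 + 1 / real n = real (Suc n) / real n" using False by (simp add: field_simps)
      thus ?thesis using False by (simp add: ln_div del: of_nat_Suc)
    qed
    also have "\<dots> \<le> real n * (1 / real n)"
      by (intro mult_left_mono ln_add_one_self_le_self) auto
    finally have "real n * (ln (real (Suc n)) - ln (real n)) \<le> 1" using False by simp
    thus ?thesis using Suc by (simp add: ln_fact_Suc algebra_simps del: fact_Suc)
  qed simp
qed simp

lemma ln_fact_upper:
  assumes "n \<ge> 1"
  shows "ln (fact n) \<le> real n * ln (real n) - real n + 1 + ln (real n)"
  using assms
proof (induction n rule: dec_induct)
  case (step n)
  have "ln (real n / real (Suc n)) \<le> real n / real (Suc n) - 1"
    using step by (intro ln_le_minus_one) auto
  hence "ln (real (Suc n)) - ln (real n) \<ge> 1 / real (Suc n)"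
    using step by (simp add: ln_div field_simps)
  hence "real (Suc n) * (ln (real (Suc n)) - ln (real n)) \<ge> real (Suc n) * (1 / real (Suc n))"
    by (intro mult_left_mono) auto
  hence "real (Suc n) * (ln (real (Suc n)) - ln (real n)) \<ge> 1" by simp
  thus ?case using step by (simp add: ln_fact_Suc algebra_simps del: fact_Suc)
qed simp

text \<open>Needed to compare \<open>N div j\<close> with the real quotient: rounding
  \<open>y\<close> down to \<open>n\<close> shifts \<open>y * ln y - y\<close> by at most
  \<open>1 + ln y\<close>, and Stirling for \<open>n\<close> costs as much again.\<close>

lemma ln_fact_floor_approx:
  fixes y :: real
  assumes "real n \<le> y" "y < real n + 1" "n \<ge> 1"
  shows "\<bar>ln (fact n) - (y * ln y - y)\<bar> \<le> 2 + 2 * ln y"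
proof -
  have y: "y \<ge> 1" using assms by simp
  define d where "d = y - real n"
  have d: "0 \<le> d" "d \<le> 1" using assms unfolding d_def by auto
  have eq: "y * ln y - y - (real n * ln (real n) - real n) = real n * ln (y / real n) + d * (ln y - 1)"
    using assms y unfolding d_def by (simp add: ln_div algebra_simps)
  have nonneg: "0 \<le> real n * ln (y / real n)"
    using assms y by (intro mult_nonneg_nonneg ln_ge_zero) (auto simp: field_simps)
  have "real n * ln (y / real n) \<le> real n * (y / real n - 1)"
    using assms y by (intro mult_left_mono ln_le_minus_one) auto
  also have "\<dots> = d"
    using assms unfolding d_def by (simp add: field_simps)
  finally have le: "real n * ln (y / real n) \<le> d" .
  have "0 \<le> d * ln y" "d * ln y \<le> ln y"
    using d y by (auto intro: mult_left_le_one_le)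
  moreover have "d * (ln y - 1) = d * ln y - d" by (simp add: algebra_simps)
  moreover have "0 \<le> ln (real n)" "ln (real n) \<le> ln y" using assms by auto
  ultimately show ?thesis
    using eq nonneg le ln_fact_lower[of n] ln_fact_upper[of n] assms(3) d
    unfolding abs_le_iff by linarith
qed

lemma abs_diff_alternating:
  assumes "\<bar>a1 - b1\<bar> \<le> E" "\<bar>a2 - b2\<bar> \<le> E" "\<bar>a3 - b3\<bar> \<le> E" "\<bar>a4 - b4\<bar> \<le> E" "\<bar>a5 - b5\<bar> \<le> E"
  shows "\<bar>a1 - a2 - a3 - a4 + a5 - (b1 - b2 - b3 - b4 + b5)\<bar> \<le> 5 * (E :: real)"
  using assms unfolding abs_le_iff by linarith

lemma chebyshev_sum_approx:
  assumes "N \<ge> 30"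
  shows "\<bar>chebyshev_sum N - chebyshev_const * real N\<bar> \<le> 20 * sqrt (real N)"
proof -
  define f :: "nat \<Rightarrow> real" where
    "f = (\<lambda>j. real N / real j * ln (real N / real j) - real N / real j)"
  have approx: "\<bar>ln (fact (N div j)) - f j\<bar> \<le> 2 + 2 * ln (real N)" if j: "j \<in> {1,2,3,5,30}" for j
  proof -
    have j0: "j > 0" "j \<le> 30" using j by auto
    have "\<bar>ln (fact (N div j)) - f j\<bar> \<le> 2 + 2 * ln (real N / real j)"
      unfolding f_def
    proof (rule ln_fact_floor_approx)
      show "real (N div j) \<le> real N / real j" by (rule of_nat_div_le_of_nat)
      show "real N / real j < real (N div j) + 1"
        using floor_correct[of "real N / real j"] by (simp add: floor_divide_of_nat_eq)
      show "1 \<le> N div j" using assms j0 by (simp add: Suc_le_eq div_greater_zero_iff)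
    qed
    also have "ln (real N / real j) \<le> ln (real N)"
      using j0 assms by (subst ln_le_cancel_iff) (auto simp: field_simps)
    finally show ?thesis by simp
  qed
  have f_sum: "f 1 - f 2 - f 3 - f 5 + f 30 = chebyshev_const * real N"
    using assms unfolding f_def chebyshev_const_def by (simp add: ln_div field_simps)
  \<comment> \<open>Turns the five logarithmic errors, together \<open>10 + 10 * ln N\<close>, into
    a multiple of the square root.\<close>
  have "ln (sqrt (real N)) \<le> sqrt (real N) - 1"
    using assms by (intro ln_le_minus_one) auto
  hence "ln (real N) \<le> 2 * sqrt (real N) - 2"
    using assms by (simp add: ln_sqrt)
  hence "10 + 10 * ln (real N) \<le> 20 * sqrt (real N)" by linarith
  moreover have "\<bar>ln (fact (N div 1)) - ln (fact (N div 2)) - ln (fact (N div 3))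
      - ln (fact (N div 5)) + ln (fact (N div 30)) - (f 1 - f 2 - f 3 - f 5 + f 30)\<bar>
      \<le> 5 * (2 + 2 * ln (real N))"
    by (intro abs_diff_alternating approx; simp)
  ultimately show ?thesis
    unfolding chebyshev_sum_def f_sum div_by_1 distrib_left by linarith
qed

lemma chebyshev_const_pos: "chebyshev_const > 0"
proof -
  have "ln 30 = ln (2 * 3 * 5 :: real)" by simp
  also have "\<dots> = ln 2 + ln 3 + ln 5" by (simp only: ln_mult_pos)
  finally show ?thesis
    unfolding chebyshev_const_def using ln_gt_zero[of "2::real"] ln_gt_zero[of "3::real"] ln_gt_zero[of "5::real"] by linarith
qed

text \<open>Iterating the passage from \<open>N\<close> to \<open>N div 6\<close> produces the
  factor 1 + 1/6 + 1/36 + ... = 6/5. The error reproduces itself: the square root drops to at most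
  half, and the other half of a constant of at least 40 absorbs the new 20. The value
  \<open>chebyshev_psi 30\<close> covers small \<open>N\<close>.\<close>

lemma chebyshev_psi_upper:
  "chebyshev_psi N \<le> 6 / 5 * chebyshev_const * real N + max 40 (chebyshev_psi 30) * sqrt (real N)"
proof (induction N rule: less_induct)
  case (less N)
  define K where "K = max 40 (chebyshev_psi 30)"
  have K: "K \<ge> 40" "K \<ge> chebyshev_psi 30" unfolding K_def by auto
  consider "N = 0" | "1 \<le> N" "N < 30" | "N \<ge> 30" by linarith
  then show ?case
  proof cases
    case 1
    then show ?thesis by (simp add: chebyshev_psi_def)
  next
    case 2
    have "chebyshev_psi N \<le> K * 1" using chebyshev_psi_mono[of N 30] 2 K by simp
    also have "\<dots> \<le> K * sqrt (real N)" using 2 K by (intro mult_left_mono) auto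
    also have "\<dots> \<le> 6 / 5 * chebyshev_const * real N + K * sqrt (real N)"
      using chebyshev_const_pos by simp
    finally show ?thesis unfolding K_def .
  next
    case 3
    have le: "real (N div 6) \<le> real N / 6" using of_nat_div_le_of_nat[of N 6] by simp
    have "sqrt (real (N div 6)) \<le> sqrt (real N / 4)"
      using le by (intro real_sqrt_le_mono) auto
    hence s: "sqrt (real (N div 6)) \<le> sqrt (real N) / 2" by (simp add: real_sqrt_divide)
    have "chebyshev_psi N \<le> chebyshev_psi (N div 6) + chebyshev_sum N" by (rule chebyshev_psi_le_chebyshev_sum)
    also have "\<dots> \<le> 6 / 5 * chebyshev_const * real (N div 6) + K * sqrt (real (N div 6))
        + chebyshev_const * real N + 20 * sqrt (real N)"
      using less.IH[of "N div 6", folded K_def] chebyshev_sum_approx[OF 3] 3 by linarith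
    also have "\<dots> \<le> 6 / 5 * chebyshev_const * (real N / 6) + K * (sqrt (real N) / 2)
        + chebyshev_const * real N + K / 2 * sqrt (real N)"
      using le s chebyshev_const_pos K by (intro add_mono mult_left_mono mult_right_mono) auto
    also have "\<dots> = 6 / 5 * chebyshev_const * real N + K * sqrt (real N)"
      by (simp add: algebra_simps)
    finally show ?thesis unfolding K_def .
  qed
qed

text \<open>Only prime powers with exponent at least 2 contribute; their base is at most the square
  root of \<open>N\<close>, their exponent at most \<open>log 2 N\<close>, and each adds at most
  \<open>ln N\<close>.\<close>

lemma sum_mangoldt_no_primes_le:
  assumes "\<And>p. prime p \<Longrightarrow> M < p \<Longrightarrow> p \<le> N \<Longrightarrow> False" and "N \<ge> 1"
  shows "(\<Sum>d=M+1..N. mangoldt d) \<le> (sqrt (real N) + 1) * (log 2 (real N) + 1) * ln (real N)"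
proof -
  define R where "R = nat \<lfloor>sqrt (real N)\<rfloor>"
  define L where "L = nat \<lfloor>log 2 (real N)\<rfloor>"
  define S where "S = {d \<in> {M+1..N}. primepow d}"
  have "S \<subseteq> (\<lambda>(p, k). p ^ k) ` ({0..R} \<times> {0..L})"
  proof
    fix d assume d: "d \<in> S"
    then obtain p k where pk: "prime p" "k > 0" "d = p ^ k"
      unfolding S_def primepow_def by auto
    have "k \<noteq> 1" using assms(1)[of p] d pk unfolding S_def by auto
    hence k2: "k \<ge> 2" using pk by linarith
    have p2: "p \<ge> 2" using pk(1) by (rule prime_ge_2_nat)
    have dN: "d \<le> N" using d unfolding S_def by auto
    have "p ^ 2 \<le> p ^ k" using p2 k2 by (intro power_increasing) auto
    hence "p ^ 2 \<le> N" using dN pk by simp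
    hence "real p ^ 2 \<le> real N" by (simp flip: of_nat_power)
    hence "real p \<le> sqrt (real N)" by (rule real_le_rsqrt)
    hence "p \<le> R" unfolding R_def by (simp add: le_nat_floor)
    have "2 ^ k \<le> p ^ k" using p2 by (rule power_mono) simp
    hence "2 ^ k \<le> N" using dN pk by linarith
    hence "(2::real) ^ k \<le> real N" by (metis of_nat_le_iff of_nat_numeral of_nat_power)
    hence "real k \<le> log 2 (real N)"
      using assms(2) by (simp add: le_log_iff powr_realpow)
    hence "k \<le> L" unfolding L_def by (simp add: le_nat_floor)
    thus "d \<in> (\<lambda>(p, k). p ^ k) ` ({0..R} \<times> {0..L})" using \<open>p \<le> R\<close> pk by auto
  qed
  hence "card S \<le> card ((\<lambda>(p, k). p ^ k) ` ({0..R} \<times> {0..L}))" by (intro card_mono) auto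
  also have "\<dots> \<le> card ({0..R} \<times> {0..L})" by (rule card_image_le) auto
  also have "\<dots> = (R + 1) * (L + 1)" by simp
  finally have "real (card S) \<le> real ((R + 1) * (L + 1))" by linarith
  also have "\<dots> = (real R + 1) * (real L + 1)" by (simp only: of_nat_mult of_nat_add of_nat_1)
  also have "\<dots> \<le> (sqrt (real N) + 1) * (log 2 (real N) + 1)"
    using assms(2) unfolding R_def L_def by (intro mult_mono add_mono) auto
  finally have card: "real (card S) \<le> (sqrt (real N) + 1) * (log 2 (real N) + 1)" .
  have "(\<Sum>d=M+1..N. mangoldt d :: real) = (\<Sum>d\<in>S. mangoldt d)"
    unfolding S_def by (rule sum.mono_neutral_right) (auto simp: mangoldt_def)
  also have "\<dots> \<le> (\<Sum>d\<in>S. ln (real N))"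
  proof (rule sum_mono)
    fix d assume "d \<in> S"
    hence "d > 0" "d \<le> N" unfolding S_def by auto
    thus "mangoldt d \<le> ln (real N)" using mangoldt_le[of d] by (smt (verit) ln_mono of_nat_0_less_iff of_nat_le_iff)
  qed
  also have "\<dots> = real (card S) * ln (real N)" by simp
  also have "\<dots> \<le> (sqrt (real N) + 1) * (log 2 (real N) + 1) * ln (real N)"
    using card assms(2) by (intro mult_right_mono) auto
  finally show ?thesis .
qed

text \<open>Without such a prime, \<open>chebyshev_psi\<close> would grow by little more than a
  square root between \<open>M\<close> and 1.22 \<open>M\<close>. But the lower bound with factor
  1.21 beats the upper bound with factor 6/5 by \<open>chebyshev_const * M / 100\<close>.\<close>

lemma eventually_prime_between:
  "\<forall>\<^sub>F M in sequentially. \<exists>p. prime p \<and> M < p \<and> 100 * p \<le> 122 * M"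
proof -
  define K where "K = max 40 (chebyshev_psi 30)"
  have A: "chebyshev_const > 0" by (rule chebyshev_const_pos)
  have "\<forall>\<^sub>F M in sequentially. (sqrt (2 * real M) + 1) * (log 2 (2 * real M) + 1) * ln (2 * real M)
      + K * sqrt (real M) + 20 * sqrt (2 * real M) < chebyshev_const * (real M / 100)"
    using A by real_asymp
  moreover have "\<forall>\<^sub>F M::nat in sequentially. M \<ge> 100" by (rule eventually_ge_at_top)
  ultimately show ?thesis
  proof eventually_elim
    case (elim M)
    \<comment> \<open>Rounding down loses less than 1, so 1.22 becomes 1.21 once \<open>M\<close> is
      at least 100.\<close>
    define N where "N = 122 * M div 100"
    have N: "100 * N \<le> 122 * M" "122 * M < 100 * N + 100" unfolding N_def by auto
    have N': "N \<le> 2 * M" "121 * M \<le> 100 * N" "N \<ge> 30" "M \<le> N" using N elim by auto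
    show ?case
    proof (rule ccontr)
      assume neg: "\<not> ?thesis"
      have no: False if "prime p" "M < p" "p \<le> N" for p
      proof -
        have "100 * p \<le> 122 * M" using that N by linarith
        thus False using neg that by blast
      qed
      have "chebyshev_psi N = (\<Sum>d\<in>{1..M} \<union> {M+1..N}. mangoldt d)"
        unfolding chebyshev_psi_def using N' by (intro sum.cong) auto
      also have "\<dots> = chebyshev_psi M + (\<Sum>d=M+1..N. mangoldt d)"
        unfolding chebyshev_psi_def by (rule sum.union_disjoint) auto
      also have "(\<Sum>d=M+1..N. mangoldt d) \<le> (sqrt (real N) + 1) * (log 2 (real N) + 1) * ln (real N)"
        using no N' by (intro sum_mangoldt_no_primes_le) auto
      also have "\<dots> \<le> (sqrt (2 * real M) + 1) * (log 2 (2 * real M) + 1) * ln (2 * real M)"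
        using N' elim by (intro mult_mono add_mono real_sqrt_le_mono) auto
      finally have 1: "chebyshev_psi N \<le> chebyshev_psi M +
          (sqrt (2 * real M) + 1) * (log 2 (2 * real M) + 1) * ln (2 * real M)" by simp
      have 2: "chebyshev_psi M \<le> 6 / 5 * chebyshev_const * real M + K * sqrt (real M)"
        unfolding K_def by (rule chebyshev_psi_upper)
      have "chebyshev_const * real N - 20 * sqrt (real N) \<le> chebyshev_sum N"
        using chebyshev_sum_approx[of N] N' by linarith
      moreover have "sqrt (real N) \<le> sqrt (2 * real M)" using N' by simp
      moreover have "chebyshev_const * (121 / 100 * real M) \<le> chebyshev_const * real N"
        using A N' by (intro mult_left_mono) auto
      ultimately have 3: "chebyshev_const * (121 / 100 * real M) - 20 * sqrt (2 * real M) \<le> chebyshev_psi N"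
        using chebyshev_sum_le_chebyshev_psi[of N] by linarith
      have "chebyshev_const * (121 / 100 * real M) - 6 / 5 * chebyshev_const * real M
          = chebyshev_const * (real M / 100)" by (simp add: algebra_simps)
      thus False using 1 2 3 elim by linarith
    qed
  qed
qed

subsection \<open>Sums of points on parabolas modulo a prime\<close>

text \<open>By Euler's criterion a nonresidue raised to \<open>(p - 1) div 2\<close> is -1; if the
  product were a nonresidue as well, 1 and -1 would agree modulo \<open>p\<close>.\<close>

lemma QuadRes_mult_nonresidues:
  assumes p: "prime p" "2 < p" and a: "\<not> QuadRes (int p) a" and b: "\<not> QuadRes (int p) b"
  shows "QuadRes (int p) (a * b)"
proof (rule ccontr)
  assume ab: "\<not> QuadRes (int p) (a * b)"
  have nz: "\<not> [x = 0] (mod int p)" if "\<not> QuadRes (int p) x" for x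
  proof
    assume "[x = 0] (mod int p)"
    hence "[0\<^sup>2 = x] (mod int p)" by (simp add: cong_sym)
    thus False using that unfolding QuadRes_def by blast
  qed
  have L: "[- 1 = x ^ ((p - 1) div 2)] (mod int p)" if "\<not> QuadRes (int p) x" for x
    using euler_criterion[OF p, of x] that nz[OF that] unfolding Legendre_def by simp
  have "[(- 1) * (- 1) = a ^ ((p - 1) div 2) * b ^ ((p - 1) div 2)] (mod int p)"
    using L[OF a] L[OF b] by (rule cong_mult)
  hence "[1 = (a * b) ^ ((p - 1) div 2)] (mod int p)" by (simp add: power_mult_distrib)
  hence "[1 = - 1] (mod int p)" using L[OF ab] by (meson cong_sym cong_trans)
  hence "int p dvd 2" by (simp add: cong_iff_dvd_diff)
  hence "int p \<le> 2" by (rule zdvd_imp_le) simp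
  thus False using p by simp
qed

text \<open>Counting: with p = 2h + 1 there are at most h + 1 squares and four forbidden values,
  fewer than p in total as soon as p > 9. The roots of \<open>3 * s + 1\<close> account for two of
  the four, since this number could be \<open>p\<close> or \<open>2 * p\<close>.\<close>

lemma exists_nonresidue:
  assumes p: "prime p" "9 < p"
  obtains s where "\<not> QuadRes (int p) s" "\<not> int p dvd s + 1" "\<not> int p dvd s + 3" "\<not> int p dvd 3 * s + 1"
proof -
  have "odd p" using p by (simp add: prime_odd_nat)
  then obtain h' where "p = 2 * h' + 1" by (elim oddE)
  define h where "h = int h'"
  have h: "int p = 2 * h + 1" unfolding h_def \<open>p = 2 * h' + 1\<close> by simp
  define Sq where "Sq = (\<lambda>u. u\<^sup>2 mod int p) ` {0..h}"
  define E where "E = {int p - 1, int p - 3, (int p - 1) div 3, (2 * int p - 1) div 3}"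
  have "card (Sq \<union> E) \<le> card Sq + card E" by (rule card_Un_le)
  also have "card Sq \<le> card {0..h}" unfolding Sq_def by (rule card_image_le) simp
  also have "card E \<le> 4"
    using card_length[of "[int p - 1, int p - 3, (int p - 1) div 3, (2 * int p - 1) div 3]"]
    unfolding E_def by (simp only: list.set list.size)
  finally have "card (Sq \<union> E) < card {0..<int p}" using h p by simp
  moreover have "finite (Sq \<union> E)" unfolding Sq_def E_def by simp
  ultimately have "\<not> {0..<int p} \<subseteq> Sq \<union> E" using card_mono leD by blast
  then obtain s where "s \<in> {0..<int p}" "s \<notin> Sq \<union> E" by blast
  hence s: "0 \<le> s" "s < int p" "s \<notin> Sq" "s \<notin> E" by simp_all
  show thesis
  proof
    show "\<not> QuadRes (int p) s"
    proof
      assume "QuadRes (int p) s"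
      then obtain y where y: "[y\<^sup>2 = s] (mod int p)" unfolding QuadRes_def by auto
      define z where "z = y mod int p"
      \<comment> \<open>Of a root and its negative one lies in the lower half, hence h + 1 values
        give all squares.\<close>
      define u where "u = (if z \<le> h then z else int p - z)"
      have z: "0 \<le> z" "z < int p" unfolding z_def using p by auto
      have "[u\<^sup>2 = z\<^sup>2] (mod int p)"
      proof (cases "z \<le> h")
        case False
        have "(int p - z)\<^sup>2 - z\<^sup>2 = int p * (int p - 2 * z)"
          by (simp add: power2_eq_square algebra_simps)
        thus ?thesis using False unfolding u_def cong_iff_dvd_diff by simp
      qed (simp add: u_def)
      also have "[z\<^sup>2 = y\<^sup>2] (mod int p)" unfolding z_def by (simp add: cong_def power_mod)
      also note y
      finally have "s = u\<^sup>2 mod int p" using s by (simp add: cong_def)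
      moreover have "u \<in> {0..h}" unfolding u_def using z h by auto
      ultimately show False using s(3) unfolding Sq_def by blast
    qed
    have ne: "s \<noteq> int p - 1" "s \<noteq> int p - 3" "s \<noteq> (int p - 1) div 3" "s \<noteq> (2 * int p - 1) div 3"
      using s(4) unfolding E_def by simp_all
    show "\<not> int p dvd s + 1"
    proof
      assume "int p dvd s + 1"
      hence "int p \<le> s + 1" using s(1) by (intro zdvd_imp_le) linarith+
      thus False using s(2) ne(1) by linarith
    qed
    show "\<not> int p dvd s + 3"
    proof
      assume "int p dvd s + 3"
      then obtain q where q: "s + 3 = int p * q" by (elim dvdE)
      have "int p * 0 < int p * q" "int p * q < int p * 2" using q s p(2) by linarith+
      hence "0 < q" "q < 2" using p(2) by (simp_all only: mult_less_cancel_left_pos of_nat_0_less_iff)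
      hence "q = 1" by linarith
      thus False using q ne(2) by simp
    qed
    show "\<not> int p dvd 3 * s + 1"
    proof
      assume "int p dvd 3 * s + 1"
      then obtain q where q: "3 * s + 1 = int p * q" by (elim dvdE)
      have "int p * 0 < int p * q" "int p * q < int p * 3" using q s p(2) by linarith+
      hence "0 < q" "q < 3" using p(2) by (simp_all only: mult_less_cancel_left_pos of_nat_0_less_iff)
      hence "q = 1 \<or> q = 2" by linarith
      moreover have "s = (int p * q - 1) div 3" unfolding q [symmetric] by simp
      ultimately show False using ne(3,4) by (auto simp: mult.commute)
    qed
  qed
qed

section \<open>Pairs of points on two parabolas with a given sum\<close>

lemma card_le_2I:
  assumes "finite S" and "\<And>x y z. x \<in> S \<Longrightarrow> y \<in> S \<Longrightarrow> z \<in> S \<Longrightarrow> x \<noteq> y \<Longrightarrow> x \<noteq> z \<Longrightarrow> y \<noteq> z \<Longrightarrow> False"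
  shows "card S \<le> 2"
proof (rule ccontr)
  assume "\<not> card S \<le> 2"
  then obtain T where T: "T \<subseteq> S" "card T = 3"
    using obtain_subset_with_card_n[of 3 S] by auto
  then obtain x y z where "T = {x, y, z}" "x \<noteq> y" "y \<noteq> z" "x \<noteq> z" by (auto simp: card_3_iff)
  thus False using assms(2)[of x y z] T by auto
qed

text \<open>Abscissas of a point on v = k u^2 and a point on v = l u^2 whose sum in the plane modulo
  \<open>p\<close> is \<open>(a, b)\<close>.\<close>

definition parabola_sols :: "int \<Rightarrow> int \<Rightarrow> int \<Rightarrow> int \<Rightarrow> int \<Rightarrow> (int \<times> int) set" where
  "parabola_sols p k l a b = {(u, u'). u \<in> {0..<p} \<and> u' \<in> {0..<p} \<and> [u + u' = a] (mod p) \<and>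
     [k * u\<^sup>2 + l * u'\<^sup>2 = b] (mod p)}"

lemma finite_parabola_sols [simp]: "finite (parabola_sols p k l a b)"
  by (rule finite_subset[of _ "{0..<p} \<times> {0..<p}"]) (auto simp: parabola_sols_def)

lemma cong_residues_eq:
  fixes u v p :: int
  assumes "u \<in> {0..<p}" "v \<in> {0..<p}" "p dvd u - v"
  shows "u = v"
proof -
  have "u mod p = v mod p" using assms(3) by (simp add: mod_eq_dvd_iff)
  thus ?thesis using assms(1,2) by simp
qed

text \<open>Substituting u' = a - u leaves a quadratic in u with leading coefficient
  \<open>k + l\<close>, a unit modulo \<open>p\<close>. Concretely, two distinct roots have a
  prescribed sum, so three distinct roots cannot exist.\<close>

lemma card_parabola_sols:
  assumes p: "prime (p :: int)" and kl: "\<not> p dvd k + l"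
  shows "card (parabola_sols p k l a b) \<le> 2"
proof (rule card_le_2I)
  have diff: "p dvd (k + l) * (u + v) - 2 * l * a"
    if "(u, u') \<in> parabola_sols p k l a b" "(v, v') \<in> parabola_sols p k l a b" "u \<noteq> v" for u u' v v'
  proof -
    have "p dvd (u + u') - a" "p dvd (v + v') - a"
      and b: "p dvd k * u\<^sup>2 + l * u'\<^sup>2 - b" "p dvd k * v\<^sup>2 + l * v'\<^sup>2 - b"
      using that unfolding parabola_sols_def by (simp_all add: cong_iff_dvd_diff)
    moreover have "p dvd (k * u\<^sup>2 + l * u'\<^sup>2) - (k * v\<^sup>2 + l * v'\<^sup>2)"
      using dvd_diff[OF b] by (simp add: algebra_simps)
    ultimately obtain i j r where i: "(u + u') - a = p * i" and j: "(v + v') - a = p * j"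
      and r: "(k * u\<^sup>2 + l * u'\<^sup>2) - (k * v\<^sup>2 + l * v'\<^sup>2) = p * r"
      by (elim dvdE) blast
    have u': "u' = a - u + p * i" and v': "v' = a - v + p * j" using i j by linarith+
    have "p dvd (u - v) * ((k + l) * (u + v) - 2 * l * a)"
    proof
      show "(u - v) * ((k + l) * (u + v) - 2 * l * a)
        = p * (r - l * (i * (2 * (a - u) + p * i)) + l * (j * (2 * (a - v) + p * j)))"
        unfolding right_diff_distrib distrib_left r [symmetric] u' v'
        by (simp add: power2_eq_square algebra_simps)
    qed
    moreover have "\<not> p dvd u - v"
      using that cong_residues_eq[of u p v] unfolding parabola_sols_def by auto
    ultimately show ?thesis using p by (simp add: prime_dvd_mult_iff)
  qed
  have fst_inj: "u' = v'" if "(u, u') \<in> parabola_sols p k l a b" "(u, v') \<in> parabola_sols p k l a b" for u u' v'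
  proof (rule cong_residues_eq[of _ p])
    have "p dvd u + u' - a" "p dvd u + v' - a"
      using that unfolding parabola_sols_def by (simp_all add: cong_iff_dvd_diff)
    hence "p dvd (u + u' - a) - (u + v' - a)" by (rule dvd_diff)
    thus "p dvd u' - v'" by simp
  qed (use that in \<open>auto simp: parabola_sols_def\<close>)
  fix x y z
  assume S: "x \<in> parabola_sols p k l a b" "y \<in> parabola_sols p k l a b" "z \<in> parabola_sols p k l a b"
    and ne: "x \<noteq> y" "x \<noteq> z" "y \<noteq> z"
  obtain u u' v v' w w' where xyz: "x = (u, u')" "y = (v, v')" "z = (w, w')" by (cases x, cases y, cases z)
  have uvw: "u \<noteq> v" "u \<noteq> w" "v \<noteq> w" using S ne fst_inj unfolding xyz by auto
  have "p dvd ((k + l) * (u + v) - 2 * l * a) - ((k + l) * (u + w) - 2 * l * a)"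
    using S uvw unfolding xyz by (intro dvd_diff diff)
  hence "p dvd (k + l) * (v - w)" by (simp add: algebra_simps)
  hence "p dvd v - w" using p kl by (simp add: prime_dvd_mult_iff)
  thus False using cong_residues_eq[of v p w] S uvw unfolding xyz parabola_sols_def by auto
qed simp

lemma linear_cong_solvable:
  fixes p c d :: int
  assumes "prime p" "\<not> p dvd c"
  obtains u where "u \<in> {0..<p}" "[c * u = d] (mod p)"
proof -
  have "coprime c p" using assms by (metis coprime_commute prime_imp_coprime)
  then obtain x where x: "[c * x = 1] (mod p)" using cong_solve_coprime_int by blast
  have "p > 0" using assms(1) by (rule prime_gt_0_int)
  have "[c * (x * d mod p) = c * (x * d)] (mod p)" by (simp add: cong_def mod_mult_right_eq)
  also have "c * (x * d) = (c * x) * d" by simp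
  also have "[(c * x) * d = 1 * d] (mod p)" using x by (rule cong_scalar_right)
  finally show thesis using that[of "x * d mod p"] \<open>p > 0\<close> by simp
qed

text \<open>
  With \<open>u' = a - u\<close>, the equation \<open>s(s+1) u\<^sup>2 + (s+1) u'\<^sup>2 = b\<close> reads \<open>((s+1) u - a)\<^sup>2 = D\<close> and
  \<open>2s u\<^sup>2 + 2s u'\<^sup>2 = b\<close> times \<open>s\<close> reads \<open>(2s u - s a)\<^sup>2 = s D\<close>, where \<open>D = b - s a\<^sup>2\<close>.
\<close>

lemma parabola_cover:
  assumes p: "prime p" "2 < p" and s: "\<not> QuadRes (int p) s" "\<not> int p dvd s + 1"
  shows "parabola_sols (int p) (2 * s) (2 * s) a b \<noteq> {} \<or>
    parabola_sols (int p) (s * (s + 1)) (s + 1) a b \<noteq> {}"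
proof -
  let ?p = "int p"
  have pr: "prime ?p" using p by simp
  have s0: "\<not> ?p dvd s"
  proof
    assume "?p dvd s"
    hence "[0\<^sup>2 = s] (mod ?p)" by (simp add: cong_iff_dvd_diff)
    thus False using s(1) unfolding QuadRes_def by blast
  qed
  have p2: "\<not> ?p dvd 2" using p by (auto dest: zdvd_imp_le)
  have sol: "(u, (a - u) mod ?p) \<in> parabola_sols ?p k l a b"
    if "u \<in> {0..<?p}" "?p dvd k * u\<^sup>2 + l * (a - u)\<^sup>2 - b" for u k l
  proof -
    have "[u + (a - u) mod ?p = u + (a - u)] (mod ?p)" by (simp add: cong_def mod_add_right_eq)
    moreover have "[k * u\<^sup>2 + l * ((a - u) mod ?p)\<^sup>2 = k * u\<^sup>2 + l * (a - u)\<^sup>2] (mod ?p)"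
      by (intro cong_add cong_mult cong_refl cong_pow) (simp add: cong_def)
    moreover have "[k * u\<^sup>2 + l * (a - u)\<^sup>2 = b] (mod ?p)" using that(2) by (simp add: cong_iff_dvd_diff)
    ultimately show ?thesis
      using that(1) p unfolding parabola_sols_def by (auto intro: cong_trans)
  qed
  show ?thesis
  proof (cases "QuadRes ?p (b - s * a\<^sup>2)")
    case True
    then obtain w where "[w\<^sup>2 = b - s * a\<^sup>2] (mod ?p)" unfolding QuadRes_def by blast
    hence w: "?p dvd w\<^sup>2 - (b - s * a\<^sup>2)" by (simp add: cong_iff_dvd_diff)
    obtain u where u: "u \<in> {0..<?p}" "[(s + 1) * u = a + w] (mod ?p)"
      using linear_cong_solvable[OF pr s(2)] by blast
    obtain r where r: "(s + 1) * u - (a + w) = ?p * r"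
      using u(2) unfolding cong_iff_dvd_diff by (elim dvdE)
    obtain t where t: "w\<^sup>2 - (b - s * a\<^sup>2) = ?p * t" using w by (elim dvdE)
    have "s * (s + 1) * u\<^sup>2 + (s + 1) * (a - u)\<^sup>2 - b = ?p * (t + r * (2 * w + ?p * r))"
    proof -
      have "(s + 1) * u - a = w + ?p * r" using r by linarith
      moreover have "s * (s + 1) * u\<^sup>2 + (s + 1) * (a - u)\<^sup>2 - b
          = ((s + 1) * u - a)\<^sup>2 - (b - s * a\<^sup>2)"
        by (simp add: power2_eq_square algebra_simps)
      ultimately have "s * (s + 1) * u\<^sup>2 + (s + 1) * (a - u)\<^sup>2 - b
          = w\<^sup>2 - (b - s * a\<^sup>2) + ?p * (r * (2 * w + ?p * r))"
        by (simp add: power2_eq_square algebra_simps)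
      thus ?thesis unfolding t by (simp add: algebra_simps)
    qed
    thus ?thesis using sol[OF u(1), of "s * (s + 1)" "s + 1"] by auto
  next
    case False
    hence "QuadRes ?p (s * (b - s * a\<^sup>2))" using QuadRes_mult_nonresidues[OF p s(1)] by simp
    then obtain w where "[w\<^sup>2 = s * (b - s * a\<^sup>2)] (mod ?p)" unfolding QuadRes_def by blast
    then obtain t where t: "w\<^sup>2 - s * (b - s * a\<^sup>2) = ?p * t"
      unfolding cong_iff_dvd_diff by (elim dvdE)
    have "\<not> ?p dvd 2 * s" using p2 s0 pr by (simp add: prime_dvd_mult_iff)
    then obtain u where u: "u \<in> {0..<?p}" "[(2 * s) * u = s * a + w] (mod ?p)"
      using linear_cong_solvable[OF pr] by blast
    obtain r where r: "(2 * s) * u - (s * a + w) = ?p * r"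
      using u(2) unfolding cong_iff_dvd_diff by (elim dvdE)
    have "s * (2 * s * u\<^sup>2 + 2 * s * (a - u)\<^sup>2 - b) = ?p * (t + r * (2 * w + ?p * r))"
    proof -
      have "2 * s * u - s * a = w + ?p * r" using r by linarith
      moreover have "s * (2 * s * u\<^sup>2 + 2 * s * (a - u)\<^sup>2 - b)
          = (2 * s * u - s * a)\<^sup>2 - s * (b - s * a\<^sup>2)"
        by (simp add: power2_eq_square algebra_simps)
      ultimately have "s * (2 * s * u\<^sup>2 + 2 * s * (a - u)\<^sup>2 - b)
          = w\<^sup>2 - s * (b - s * a\<^sup>2) + ?p * (r * (2 * w + ?p * r))"
        by (simp add: power2_eq_square algebra_simps)
      thus ?thesis unfolding t by (simp add: algebra_simps)
    qed
    hence "?p dvd s * (2 * s * u\<^sup>2 + 2 * s * (a - u)\<^sup>2 - b)" by simp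
    hence "?p dvd 2 * s * u\<^sup>2 + 2 * s * (a - u)\<^sup>2 - b" using s0 pr by (simp add: prime_dvd_mult_iff)
    thus ?thesis using sol[OF u(1), of "2 * s" "2 * s"] by auto
  qed
qed

subsection \<open>Placing the parabolas in the integers modulo \<open>m\<close>\<close>

text \<open>
  The translates of the parabola number \<open>i\<close> are indexed by \<open>part i \<times> part (swap12 i)\<close>. A target
  offset \<open>e\<close> arises either as \<open>x + y = e\<close> or, after a carry, as \<open>x + y = e - 1\<close>;
  \<open>spread\<close> tabulates the maximum of the two counts.
\<close>

definition part :: "nat \<Rightarrow> int list" where
  "part a = [[0, 1], [0], [0, 1, 2]] ! a"

definition sum_count :: "nat \<Rightarrow> nat \<Rightarrow> int \<Rightarrow> nat" where
  "sum_count a b e = length (filter (\<lambda>(x, y). x + y = e) (List.product (part a) (part b)))"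

definition spread :: "nat \<Rightarrow> nat \<Rightarrow> int \<Rightarrow> nat" where
  "spread a b e =
    [[[1, 2, 2, 1, 0, 0], [1, 1, 1, 0, 0, 0], [1, 2, 2, 2, 1, 0]],
     [[1, 1, 1, 0, 0, 0], [1, 1, 0, 0, 0, 0], [1, 1, 1, 1, 0, 0]],
     [[1, 2, 2, 2, 1, 0], [1, 1, 1, 1, 0, 0], [1, 2, 3, 3, 2, 1]]] ! a ! b ! nat e"

text \<open>Here \<alpha> is the carry. Two shifts of at most 2 and a carry of at most 1 give
  offsets up to 5.\<close>

lemma sum_count_le_spread_aux:
  "\<forall>a\<in>set [0, 1, 2]. \<forall>b\<in>set [0, 1, 2]. \<forall>e\<in>set [0, 1, 2, 3, 4, 5]. \<forall>\<alpha>\<in>set [0, 1].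
     sum_count a b (e - \<alpha>) \<le> spread a b e"
  by code_simp

text \<open>Balances the two directions: parabola 1 gets one horizontal and three vertical shifts,
  parabola 2 the reverse, parabola 0 two of each.\<close>

definition swap12 :: "nat \<Rightarrow> nat" where
  "swap12 i = [0, 2, 1] ! i"

text \<open>Bounds the shift choices over all ordered pairs of parabolas at horizontal offset
  \<open>e\<close> and vertical offset \<open>b\<close>. List sums allow evaluation by code.\<close>

definition total_weight :: "int \<Rightarrow> int \<Rightarrow> nat" where
  "total_weight e b = (\<Sum>i\<leftarrow>[0, 1, 2]. \<Sum>j\<leftarrow>[0, 1, 2]. spread i j e * spread (swap12 i) (swap12 j) b)"

definition weight_table :: "int \<Rightarrow> int \<Rightarrow> nat" where
  "weight_table e b = (if 0 \<le> b \<and> b \<le> 5 then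
     [[9, 13, 13, 10, 4, 1], [13, 18, 17, 11, 4, 1], [13, 17, 14, 8, 2, 0],
      [10, 11, 8, 3, 0, 0], [4, 4, 2, 0, 0, 0], [1, 1, 0, 0, 0, 0]] ! nat e ! nat b else 0)"

lemma total_weight_eq_table_aux:
  "\<forall>e\<in>set [0, 1, 2, 3, 4, 5]. \<forall>b\<in>set [0, 1, 2, 3, 4, 5]. total_weight e b = weight_table e b"
  by code_simp

text \<open>
  \<open>column_weight b\<close> is the larger of the two sums of \<open>weight_table e b\<close> over \<open>e\<close> of fixed parity.
\<close>

definition column_weight :: "int \<Rightarrow> nat" where
  "column_weight b = (if 0 \<le> b \<and> b \<le> 5 then [26, 34, 29, 18, 6, 1] ! nat b else 0)"

text \<open>The mixed sums occur when lowering the level by one or two crosses a multiple of \<open>p\<close>.\<close>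

lemma column_weight_bound_aux:
  "\<forall>e\<in>set [0, 1]. \<forall>b\<in>set [0, 1, 2, 3, 4, 5, 6].
     weight_table e b + weight_table (e + 2) b + weight_table (e + 4) b \<le> column_weight b \<and>
     weight_table e b + weight_table (e + 2) b + weight_table (e + 4) (b - 1)
       \<le> max (column_weight b) (column_weight (b - 1)) \<and>
     weight_table e b + weight_table (e + 2) (b - 1) + weight_table (e + 4) (b - 1)
       \<le> max (column_weight b) (column_weight (b - 1))"
  by code_simp

text \<open>\<open>Y\<close>, \<open>Y - 1\<close>, \<open>Y - 2\<close> are the levels belonging to
  the three offsets of equal parity. As \<open>P\<close> is at least 3, they cross at most one
  multiple of \<open>P\<close>, so the column \<open>b\<close> can be taken as
  \<open>Y div P\<close> or its predecessor.\<close>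

lemma column_bound:
  assumes P: "P \<ge> (3 :: int)" and Y: "Y \<ge> 0" and e: "e = 0 \<or> e = 1"
  shows "\<exists>b. weight_table e (Y div P) + weight_table (e + 2) ((Y - 1) div P)
      + weight_table (e + 4) ((Y - 2) div P) \<le> column_weight b \<and> P * b \<le> Y \<and> Y - 2 < P * (b + 1)"
proof -
  define c where "c = Y div P"
  define f where "f = Y mod P"
  have Yeq: "Y = P * c + f" and f: "0 \<le> f" "f < P" using P unfolding c_def f_def by auto
  have c: "c \<ge> 0" using Y P unfolding c_def by (simp add: pos_imp_zdiv_nonneg_iff)
  have div1: "(Y - 1) div P = (if f = 0 then c - 1 else c)"
    using P f unfolding Yeq by (intro int_div_pos_eq[where r = "if f = 0 then P - 1 else f - 1"]) (auto simp: algebra_simps)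
  have div2: "(Y - 2) div P = (if f \<le> 1 then c - 1 else c)"
    using P f unfolding Yeq by (intro int_div_pos_eq[where r = "if f \<le> 1 then P + f - 2 else f - 2"]) (auto simp: algebra_simps)
  have aux: "weight_table e c + weight_table (e + 2) c + weight_table (e + 4) c \<le> column_weight c" (is ?A)
      "weight_table e c + weight_table (e + 2) c + weight_table (e + 4) (c - 1)
         \<le> max (column_weight c) (column_weight (c - 1))" (is ?B)
      "weight_table e c + weight_table (e + 2) (c - 1) + weight_table (e + 4) (c - 1)
         \<le> max (column_weight c) (column_weight (c - 1))" (is ?C)
  proof -
    \<comment> \<open>From 7 on both \<open>c\<close> and \<open>c - 1\<close> lie outside the
      table, so all weights are zero.\<close>
    consider "c \<in> set [0, 1, 2, 3, 4, 5, 6]" | "c \<ge> 7" using c by fastforce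
    hence "?A \<and> ?B \<and> ?C"
    proof cases
      case 1
      moreover have "e \<in> set [0, 1]" using e by simp
      ultimately show ?thesis using column_weight_bound_aux by blast
    qed (simp add: weight_table_def)
    thus ?A ?B ?C by blast+
  qed
  have low: "P * c \<le> Y" "P * (c - 1) \<le> Y" "Y - 2 < P * (c + 1)"
    using f P unfolding Yeq by (auto simp: algebra_simps)
  show ?thesis
  proof (cases "f \<le> 1")
    case True
    hence "Y - 2 < P * ((c - 1) + 1)" unfolding Yeq by simp
    moreover have "weight_table e (Y div P) + weight_table (e + 2) ((Y - 1) div P)
      + weight_table (e + 4) ((Y - 2) div P) \<le> max (column_weight c) (column_weight (c - 1))"
      using aux(2,3) True unfolding div1 div2 c_def [symmetric] by simp
    ultimately show ?thesis using low unfolding max_def by (smt (verit))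
  next
    case False
    thus ?thesis using aux(1) low f unfolding div1 div2 c_def [symmetric] by (intro exI[of _ c]) simp
  qed
qed

lemma less_3_cases: "i < 3 \<Longrightarrow> i = 0 \<or> i = 1 \<or> i = (2 :: nat)"
  by linarith

text \<open>The conditions on \<open>s\<close> keep all pairwise sums of the three leading
  coefficients nonzero modulo \<open>p\<close>. The bound \<open>m_le\<close> serves the covering of
  all residues, \<open>m_gt\<close> the upper bound 192.\<close>

locale ruzsa_construction =
  fixes p m :: nat and s :: int
  assumes prime: "prime p" and p_ge: "5 \<le> p"
    and nonres: "\<not> QuadRes (int p) s"
    and s_dvd: "\<not> int p dvd s + 1" "\<not> int p dvd s + 3" "\<not> int p dvd 3 * s + 1"
    and m_le: "m \<le> 4 * p\<^sup>2" and m_gt: "8 * p\<^sup>2 + 4 * p < 3 * m"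
begin

abbreviation "P \<equiv> int p"
abbreviation "M \<equiv> int m"

definition coef :: "nat \<Rightarrow> int" where
  "coef i = [2 * s, s * (s + 1), s + 1] ! i"

definition height :: "nat \<Rightarrow> int \<Rightarrow> int" where
  "height i u = coef i * u\<^sup>2 mod P"

text \<open>Indices of the elements: the parabola \<open>i\<close>, the abscissa \<open>u\<close>,
  the horizontal shift \<open>r\<close> and the vertical shift \<open>t\<close>.\<close>

definition points :: "(nat \<times> int \<times> int \<times> int) set" where
  "points = {(i, u, r, t). i < 3 \<and> u \<in> {0..<P} \<and> r \<in> set (part i) \<and> t \<in> set (part (swap12 i))}"

fun pos :: "nat \<times> int \<times> int \<times> int \<Rightarrow> int" where
  "pos (i, u, r, t) = u + P * r + 2 * P * (height i u + P * t)"

definition ruzsa_set :: "int set" where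
  "ruzsa_set = (\<lambda>x. pos x mod M) ` points"

lemma P_pos: "P > 0" and P_ge: "P \<ge> 5" and prime_P: "prime P"
  using p_ge prime by auto

lemma M_le: "M \<le> 4 * P\<^sup>2" and M_gt: "8 * P\<^sup>2 + 4 * P < 3 * M" and M_gt2: "2 * P\<^sup>2 + 4 * P < M"
proof -
  have "int m \<le> int (4 * p\<^sup>2)" using m_le by (rule of_nat_mono)
  thus "M \<le> 4 * P\<^sup>2" by simp
  have "int (8 * p\<^sup>2 + 4 * p) < int (3 * m)" using m_gt by (simp only: of_nat_less_iff)
  thus 1: "8 * P\<^sup>2 + 4 * P < 3 * M" by simp
  have "5 * P \<le> P\<^sup>2" using P_ge unfolding power2_eq_square by (intro mult_right_mono) auto
  thus "2 * P\<^sup>2 + 4 * P < M" using 1 P_pos by linarith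
qed

lemma M_pos: "M > 0"
  using M_gt2 P_pos by (smt (verit) zero_le_power2)

lemma part_range: "a < 3 \<Longrightarrow> x \<in> set (part a) \<Longrightarrow> 0 \<le> x \<and> x \<le> 2"
  using less_3_cases[of a] by (auto simp: part_def)

lemma swap12_range: "i < 3 \<Longrightarrow> swap12 i < 3"
  using less_3_cases[of i] by (auto simp: swap12_def)

lemma finite_points: "finite points"
proof -
  have "points \<subseteq> {..<3} \<times> {0..<P} \<times> {0..2} \<times> {0..2}"
  proof
    fix x assume "x \<in> points"
    then obtain i u r t where x: "x = (i, u, r, t)" "i < 3" "u \<in> {0..<P}"
      "r \<in> set (part i)" "t \<in> set (part (swap12 i))" unfolding points_def by blast
    have "0 \<le> r \<and> r \<le> 2" "0 \<le> t \<and> t \<le> 2"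
      using part_range[OF x(2,4)] part_range[OF swap12_range[OF x(2)] x(5)] by auto
    thus "x \<in> {..<3} \<times> {0..<P} \<times> {0..2} \<times> {0..2}" using x by simp
  qed
  thus ?thesis by (rule finite_subset) auto
qed

text \<open>The sums factor into 2, \<open>s\<close>, \<open>s + 1\<close>, \<open>s + 3\<close> and
  \<open>3 * s + 1\<close>, all nonzero modulo \<open>p\<close>.\<close>

lemma coef_sum_not_dvd:
  assumes "i < 3" "j < 3"
  shows "\<not> P dvd coef i + coef j"
proof -
  have "\<not> P dvd s"
  proof
    assume "P dvd s"
    hence "[0\<^sup>2 = s] (mod P)" by (simp add: cong_iff_dvd_diff)
    thus False using nonres unfolding QuadRes_def by blast
  qed
  moreover have "\<not> P dvd 2" using P_ge by (auto dest: zdvd_imp_le)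
  ultimately have nd: "\<not> P dvd 2 * (2 * s)" "\<not> P dvd 2 * (s * (s + 1))" "\<not> P dvd 2 * (s + 1)"
    "\<not> P dvd s * (s + 3)" "\<not> P dvd 3 * s + 1" "\<not> P dvd (s + 1) * (s + 1)"
    using s_dvd by (simp_all only: prime_dvd_mult_iff[OF prime_P] de_Morgan_disj simp_thms)
  have eq: "2 * s + 2 * s = 2 * (2 * s)" "s * (s + 1) + s * (s + 1) = 2 * (s * (s + 1))"
    "(s + 1) + (s + 1) = 2 * (s + 1)" "2 * s + s * (s + 1) = s * (s + 3)"
    "s * (s + 1) + 2 * s = s * (s + 3)" "2 * s + (s + 1) = 3 * s + 1" "(s + 1) + 2 * s = 3 * s + 1"
    "s * (s + 1) + (s + 1) = (s + 1) * (s + 1)" "(s + 1) + s * (s + 1) = (s + 1) * (s + 1)"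
    by (simp_all add: algebra_simps)
  have coef: "coef 0 = 2 * s" "coef 1 = s * (s + 1)" "coef 2 = s + 1" by (simp_all add: coef_def)
  show ?thesis
    using assms[THEN less_3_cases] nd by (elim disjE) (simp_all only: coef eq not_False_eq_True)
qed

lemma height_range: "0 \<le> height i u" "height i u < P"
  unfolding height_def using P_pos by auto

text \<open>
  A sum \<open>S\<close> of two positions together with \<open>e\<close>, the carry of \<open>u + u'\<close> plus the shifts \<open>r + r'\<close>,
  determines the class of the sum in \<open>(\<int>/p)\<^sup>2\<close>.
\<close>

lemma key_decomposition:
  assumes "u \<in> {0..<P}" "u' \<in> {0..<P}"
    and S: "S = pos (i, u, r, t) + pos (j, u', r', t')" and e: "e = (u + u') div P + r + r'"
  defines "y \<equiv> height i u + height j u' + P * (t + t')"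
  shows "S div P = e + 2 * y" "[u + u' = S] (mod P)" "[coef i * u\<^sup>2 + coef j * u'\<^sup>2 = y] (mod P)"
    "y div P = (height i u + height j u') div P + t + t'"
proof -
  have S': "S = (u + u') + P * (r + r' + 2 * y)"
    unfolding S y_def by (simp add: algebra_simps)
  show "S div P = e + 2 * y" unfolding S' e by (subst div_mult_self2) (use P_pos in auto)
  show "[u + u' = S] (mod P)" unfolding S' by (simp add: cong_def)
  have "[height i u + height j u' = y] (mod P)" unfolding y_def by (simp add: cong_def)
  moreover have "[coef i * u\<^sup>2 + coef j * u'\<^sup>2 = height i u + height j u'] (mod P)"
    unfolding height_def by (simp add: cong_def mod_add_eq)
  ultimately show "[coef i * u\<^sup>2 + coef j * u'\<^sup>2 = y] (mod P)" by (rule cong_trans [rotated])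
  show "y div P = (height i u + height j u') div P + t + t'"
    unfolding y_def by (subst div_mult_self2) (use P_pos in auto)
qed

lemma div_carry:
  assumes "0 \<le> x" "x < P" "0 \<le> y" "y < P"
  shows "(x + y) div P = 0 \<or> (x + y) div P = 1"
proof (cases "x + y < P")
  case False
  thus ?thesis using assms by (intro disjI2 int_div_pos_eq[where r = "x + y - P"]) auto
qed (use assms in simp)

text \<open>\<open>S\<close> is a sum of integers; reduction modulo \<open>m\<close> enters only
  later, through the choice of \<open>S\<close>.\<close>

definition fibre :: "nat \<Rightarrow> nat \<Rightarrow> int \<Rightarrow> int \<Rightarrow> ((nat \<times> int \<times> int \<times> int) \<times> (nat \<times> int \<times> int \<times> int)) set" where
  "fibre i j S e = {((i', u, r, t), (j', u', r', t')). i' = i \<and> j' = j \<and>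
     (i', u, r, t) \<in> points \<and> (j', u', r', t') \<in> points \<and>
     pos (i, u, r, t) + pos (j, u', r', t') = S \<and> (u + u') div P + r + r' = e}"

text \<open>Solves \<open>S div P = e + 2 * y\<close> for the vertical coordinate \<open>y\<close>
  of the sum.\<close>

definition level :: "int \<Rightarrow> int \<Rightarrow> int" where
  "level S e = (S div P - e) div 2"

lemma sum_count_le_spread:
  assumes "a < 3" "b < 3" "0 \<le> e" "e \<le> 5" "\<alpha> = 0 \<or> \<alpha> = 1"
  shows "sum_count a b (e - \<alpha>) \<le> spread a b e"
proof -
  have "e \<in> set [0, 1, 2, 3, 4, 5]" using assms(3,4) by fastforce
  moreover have "a \<in> set [0, 1, 2]" "b \<in> set [0, 1, 2]" "\<alpha> \<in> set [0, 1]" using assms by auto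
  ultimately show ?thesis using sum_count_le_spread_aux by blast
qed

text \<open>\<open>S\<close> and \<open>e\<close> fix the target point modulo \<open>p\<close>, so
  at most two pairs \<open>(u, u')\<close> occur. For each, the carries fix \<open>r + r'\<close>
  and \<open>t + t'\<close>, and \<open>spread\<close> bounds the choices in either
  direction.\<close>

lemma card_fibre:
  assumes ij: "i < 3" "j < 3" and e: "0 \<le> e" "e \<le> 5"
  shows "card (fibre i j S e) \<le> 2 * (if 0 \<le> level S e div P \<and> level S e div P \<le> 5
    then spread i j e * spread (swap12 i) (swap12 j) (level S e div P) else 0)"
proof -
  define y where "y = level S e"
  define B where "B = y div P"
  define sols where "sols = parabola_sols P (coef i) (coef j) S y"
  \<comment> \<open>All shift choices compatible with the carries of a given
    \<open>(u, u')\<close>.\<close>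
  define G where "G = (\<lambda>(u, u'). (\<lambda>((r, r'), (t, t')). ((i, u, r, t), (j, u', r', t'))) `
    (set (filter (\<lambda>(x, y). x + y = e - (u + u') div P) (List.product (part i) (part j))) \<times>
     set (filter (\<lambda>(x, y). x + y = B - (height i u + height j u') div P)
       (List.product (part (swap12 i)) (part (swap12 j))))))"
  have sw: "swap12 i < 3" "swap12 j < 3" using swap12_range[OF ij(1)] swap12_range[OF ij(2)] by simp_all
  have mem: "(u, u') \<in> sols \<and> z \<in> G (u, u') \<and> 0 \<le> B \<and> B \<le> 5"
    if z: "z \<in> fibre i j S e" "z = ((i', u, r, t), (j', u', r', t'))" for z i' j' u r t u' r' t'
  proof -
    have pts: "u \<in> {0..<P}" "u' \<in> {0..<P}" "r \<in> set (part i)" "r' \<in> set (part j)"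
      "t \<in> set (part (swap12 i))" "t' \<in> set (part (swap12 j))"
      and S: "S = pos (i, u, r, t) + pos (j, u', r', t')" and e': "e = (u + u') div P + r + r'"
      and ij': "i' = i" "j' = j"
      using z unfolding fibre_def points_def by (auto simp del: pos.simps)
    note key = key_decomposition[OF pts(1,2) S e']
    have y: "y = height i u + height j u' + P * (t + t')"
      unfolding y_def level_def key(1) by simp
    have B: "B = (height i u + height j u') div P + t + t'"
      unfolding B_def y by (rule key(4))
    have "(height i u + height j u') div P = 0 \<or> (height i u + height j u') div P = 1"
      by (intro div_carry height_range)
    moreover have "0 \<le> t \<and> t \<le> 2" "0 \<le> t' \<and> t' \<le> 2" using part_range[OF sw(1) pts(5)] part_range[OF sw(2) pts(6)] by simp_all
    ultimately have "0 \<le> B \<and> B \<le> 5" unfolding B by linarith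
    moreover have "(u, u') \<in> sols"
      using pts(1,2) key(2,3) unfolding sols_def parabola_sols_def y by simp
    moreover have "z \<in> G (u, u')"
      unfolding z(2) ij' G_def split_conv
      by (rule image_eqI[of _ _ "((r, r'), (t, t'))"]) (use pts e' B in auto)
    ultimately show ?thesis by blast
  qed
  show ?thesis
  proof (cases "0 \<le> B \<and> B \<le> 5")
    case False
    have "z \<notin> fibre i j S e" for z
    proof
      assume z: "z \<in> fibre i j S e"
      obtain i' u r t j' u' r' t' where "z = ((i', u, r, t), (j', u', r', t'))"
        using surj_pair by metis
      thus False using mem[OF z] False by blast
    qed
    hence "fibre i j S e = {}" by blast
    thus ?thesis by simp
  next
    case True
    define W where "W = spread i j e * spread (swap12 i) (swap12 j) B"
    have "fibre i j S e \<subseteq> (\<Union>w\<in>sols. G w)"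
    proof
      fix z assume z: "z \<in> fibre i j S e"
      obtain i' u r t j' u' r' t' where z': "z = ((i', u, r, t), (j', u', r', t'))" using surj_pair by metis
      show "z \<in> (\<Union>w\<in>sols. G w)" using mem[OF z z'] by blast
    qed
    moreover have fin: "finite (G w)" for w unfolding G_def by (cases w) auto
    ultimately have "card (fibre i j S e) \<le> card (\<Union>w\<in>sols. G w)"
      unfolding sols_def by (intro card_mono) auto
    also have "\<dots> \<le> (\<Sum>w\<in>sols. card (G w))" unfolding sols_def by (rule card_UN_le) simp
    also have "\<dots> \<le> (\<Sum>w\<in>sols. W)"
    proof (rule sum_mono)
      fix w assume "w \<in> sols"
      then obtain u u' where w: "w = (u, u')" "u \<in> {0..<P}" "u' \<in> {0..<P}"
        unfolding sols_def parabola_sols_def by auto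
      define \<alpha> where "\<alpha> = (u + u') div P"
      define \<beta> where "\<beta> = (height i u + height j u') div P"
      let ?X = "filter (\<lambda>(x, y). x + y = e - \<alpha>) (List.product (part i) (part j))"
      let ?Y = "filter (\<lambda>(x, y). x + y = B - \<beta>) (List.product (part (swap12 i)) (part (swap12 j)))"
      have \<alpha>: "\<alpha> = 0 \<or> \<alpha> = 1" unfolding \<alpha>_def using w by (intro div_carry) auto
      have \<beta>: "\<beta> = 0 \<or> \<beta> = 1" unfolding \<beta>_def by (intro div_carry height_range)
      have "card (G w) \<le> card (set ?X \<times> set ?Y)"
        unfolding G_def w(1) split_conv \<alpha>_def [symmetric] \<beta>_def [symmetric] by (rule card_image_le) simp
      also have "\<dots> = card (set ?X) * card (set ?Y)" by (rule card_cartesian_product)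
      also have "\<dots> \<le> length ?X * length ?Y" by (intro mult_mono card_length) auto
      also have "\<dots> = sum_count i j (e - \<alpha>) * sum_count (swap12 i) (swap12 j) (B - \<beta>)"
        unfolding sum_count_def ..
      also have "\<dots> \<le> W"
        unfolding W_def using True by (intro mult_mono sum_count_le_spread ij sw e \<alpha> \<beta>) auto
      finally show "card (G w) \<le> W" .
    qed
    also have "\<dots> = card sols * W" by simp
    also have "\<dots> \<le> 2 * W"
      unfolding sols_def by (intro mult_right_mono card_parabola_sols prime_P coef_sum_not_dvd ij) auto
    finally show ?thesis using True unfolding W_def B_def y_def by simp
  qed
qed

lemma total_weight_eq_sum:
  "total_weight e b = (\<Sum>i<3. \<Sum>j<3. spread i j e * spread (swap12 i) (swap12 j) b)"
  by (simp add: total_weight_def numeral_3_eq_3 numeral_2_eq_2 lessThan_Suc)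

lemma sum_card_fibre_le:
  assumes e: "0 \<le> e" "e \<le> 5"
  shows "(\<Sum>i<3. \<Sum>j<3. card (fibre i j S e)) \<le> 2 * weight_table e (level S e div P)"
proof -
  define B where "B = level S e div P"
  have "(\<Sum>i<3. \<Sum>j<3. card (fibre i j S e)) \<le> (\<Sum>i<3. \<Sum>j<3. 2 * (if 0 \<le> B \<and> B \<le> 5
    then spread i j e * spread (swap12 i) (swap12 j) B else 0))"
    unfolding B_def by (intro sum_mono card_fibre e) auto
  also have "\<dots> = 2 * (if 0 \<le> B \<and> B \<le> 5 then total_weight e B else 0)"
    unfolding total_weight_eq_sum by (auto simp: sum_distrib_left)
  also have "\<dots> = 2 * weight_table e B"
  proof (cases "0 \<le> B \<and> B \<le> 5")
    case True
    hence "B \<in> set [0, 1, 2, 3, 4, 5]" by fastforce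
    moreover have "e \<in> set [0, 1, 2, 3, 4, 5]" using e by fastforce
    ultimately have "total_weight e B = weight_table e B" using total_weight_eq_table_aux by blast
    thus ?thesis using True by simp
  qed (auto simp: weight_table_def)
  finally show ?thesis unfolding B_def .
qed

section \<open>At most 192 representations of each residue class\<close>

definition rep_pairs :: "int \<Rightarrow> ((nat \<times> int \<times> int \<times> int) \<times> (nat \<times> int \<times> int \<times> int)) set" where
  "rep_pairs n = {(x, x') \<in> points \<times> points. [pos x + pos x' = n] (mod M)}"

lemma finite_rep_pairs: "finite (rep_pairs n)"
  unfolding rep_pairs_def by (rule finite_subset[of _ "points \<times> points"]) (auto simp: finite_points)

text \<open>Each pair of elements comes from at least one pair of indices, so counting indices
  overestimates.\<close>

lemma rep_count_le_card_rep_pairs: "rep_count m ruzsa_set n \<le> card (rep_pairs n)"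
proof -
  have "{(a, a') \<in> ruzsa_set \<times> ruzsa_set. [a + a' = n] (mod M)}
      \<subseteq> (\<lambda>(x, x'). (pos x mod M, pos x' mod M)) ` rep_pairs n"
  proof
    fix z assume "z \<in> {(a, a') \<in> ruzsa_set \<times> ruzsa_set. [a + a' = n] (mod M)}"
    then obtain x x' where x: "x \<in> points" "x' \<in> points" "z = (pos x mod M, pos x' mod M)"
      "[pos x mod M + pos x' mod M = n] (mod M)" unfolding ruzsa_set_def by auto
    hence "(x, x') \<in> rep_pairs n" unfolding rep_pairs_def by (simp add: cong_def mod_add_eq)
    thus "z \<in> (\<lambda>(x, x'). (pos x mod M, pos x' mod M)) ` rep_pairs n"
      by (rule rev_image_eqI) (simp add: x(3))
  qed
  hence "rep_count m ruzsa_set n \<le> card ((\<lambda>(x, x'). (pos x mod M, pos x' mod M)) ` rep_pairs n)"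
    unfolding rep_count_def by (intro card_mono finite_imageI finite_rep_pairs)
  also have "\<dots> \<le> card (rep_pairs n)" by (intro card_image_le finite_rep_pairs)
  finally show ?thesis .
qed

definition pair_sums :: "int \<Rightarrow> int set" where
  "pair_sums n = (\<lambda>(x, x'). pos x + pos x') ` rep_pairs n"

lemma finite_pair_sums: "finite (pair_sums n)"
  unfolding pair_sums_def by (intro finite_imageI finite_rep_pairs)

lemma pos_nonneg: "x \<in> points \<Longrightarrow> pos x \<ge> 0"
proof -
  assume "x \<in> points"
  then obtain i u r t where x: "x = (i, u, r, t)" "i < 3" "u \<in> {0..<P}"
    "r \<in> set (part i)" "t \<in> set (part (swap12 i))" unfolding points_def by blast
  have "0 \<le> r" "0 \<le> t" using part_range[OF x(2,4)] part_range[OF swap12_range[OF x(2)] x(5)] by auto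
  thus ?thesis using x(1,3) height_range[of i u] P_pos by simp
qed

lemma pair_sums_nonneg: "S \<in> pair_sums n \<Longrightarrow> S \<ge> 0"
  unfolding pair_sums_def rep_pairs_def by (auto intro!: add_nonneg_nonneg pos_nonneg simp del: pos.simps)

lemma pair_sums_cong: "S \<in> pair_sums n \<Longrightarrow> [S = n] (mod M)"
  unfolding pair_sums_def rep_pairs_def by (auto simp del: pos.simps)

text \<open>The candidates for \<open>e\<close> in the range 0 to 5: its parity is that of
  \<open>S div P\<close>.\<close>

definition exps :: "int \<Rightarrow> int set" where
  "exps S = {S div P mod 2, S div P mod 2 + 2, S div P mod 2 + 4}"

lemma mem_exps:
  assumes "0 \<le> e" "e \<le> 5" "S div P = e + 2 * y"
  shows "e \<in> exps S"
proof -
  have "e = e mod 2 \<or> e = e mod 2 + 2 \<or> e = e mod 2 + 4" using assms(1,2) by presburger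
  thus ?thesis unfolding exps_def assms(3) by simp
qed

lemma exps_range: "e \<in> exps S \<Longrightarrow> 0 \<le> e \<and> e \<le> 5"
  unfolding exps_def by auto

lemma rep_pairs_subset:
  "rep_pairs n \<subseteq> (\<Union>S\<in>pair_sums n. \<Union>e\<in>exps S. \<Union>i<3. \<Union>j<3. fibre i j S e)"
proof
  fix z assume z: "z \<in> rep_pairs n"
  then obtain i u r t j u' r' t' where zeq: "z = ((i, u, r, t), (j, u', r', t'))"
    and pts: "(i, u, r, t) \<in> points" "(j, u', r', t') \<in> points"
    unfolding rep_pairs_def by auto
  define S where "S = pos (i, u, r, t) + pos (j, u', r', t')"
  define e where "e = (u + u') div P + r + r'"
  have S: "S \<in> pair_sums n" unfolding pair_sums_def S_def by (rule rev_image_eqI[OF z]) (simp add: zeq)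
  have ij: "i < 3" "j < 3" and u: "u \<in> {0..<P}" "u' \<in> {0..<P}"
    and r: "r \<in> set (part i)" "r' \<in> set (part j)" using pts unfolding points_def by auto
  have "(u + u') div P = 0 \<or> (u + u') div P = 1" using u by (intro div_carry) auto
  hence "0 \<le> e" "e \<le> 5" unfolding e_def using part_range[OF ij(1) r(1)] part_range[OF ij(2) r(2)] by auto
  hence "e \<in> exps S" using key_decomposition(1)[OF u S_def e_def] by (rule mem_exps)
  moreover have "z \<in> fibre i j S e"
    unfolding fibre_def zeq using pts by (simp add: S_def e_def)
  ultimately show "z \<in> (\<Union>S\<in>pair_sums n. \<Union>e\<in>exps S. \<Union>i<3. \<Union>j<3. fibre i j S e)"
    using S ij by blast
qed

lemma finite_fibre: "finite (fibre i j S e)"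
  by (rule finite_subset[of _ "points \<times> points"])
     (auto simp: fibre_def finite_points simp del: pos.simps)

lemma card_rep_pairs_le:
  "card (rep_pairs n) \<le> (\<Sum>S\<in>pair_sums n. \<Sum>e\<in>exps S. 2 * weight_table e (level S e div P))"
proof -
  have fin: "finite (exps S)" for S unfolding exps_def by simp
  have "card (rep_pairs n) \<le> card (\<Union>S\<in>pair_sums n. \<Union>e\<in>exps S. \<Union>i<3. \<Union>j<3. fibre i j S e)"
    by (intro card_mono rep_pairs_subset finite_UN_I finite_pair_sums fin finite_fibre) auto
  also have "\<dots> \<le> (\<Sum>S\<in>pair_sums n. card (\<Union>e\<in>exps S. \<Union>i<3. \<Union>j<3. fibre i j S e))"
    by (rule card_UN_le[OF finite_pair_sums])
  also have "\<dots> \<le> (\<Sum>S\<in>pair_sums n. \<Sum>e\<in>exps S. card (\<Union>i<3. \<Union>j<3. fibre i j S e))"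
    by (intro sum_mono card_UN_le fin)
  also have "\<dots> \<le> (\<Sum>S\<in>pair_sums n. \<Sum>e\<in>exps S. \<Sum>i<3. card (\<Union>j<3. fibre i j S e))"
    by (intro sum_mono card_UN_le) auto
  also have "\<dots> \<le> (\<Sum>S\<in>pair_sums n. \<Sum>e\<in>exps S. \<Sum>i<3. \<Sum>j<3. card (fibre i j S e))"
    by (intro sum_mono card_UN_le) auto
  also have "\<dots> \<le> (\<Sum>S\<in>pair_sums n. \<Sum>e\<in>exps S. 2 * weight_table e (level S e div P))"
    by (intro sum_mono sum_card_fibre_le) (use exps_range in auto)
  finally show ?thesis .
qed

text \<open>Column \<open>b\<close> is an interval of length \<open>2 * P\<^sup>2\<close> enlarged
  by \<open>4 * P\<close>. The slack pays for levels lowered by up to two, the parity digit and the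
  remainder modulo \<open>P\<close>.\<close>

lemma column_of_sum:
  assumes "S \<ge> 0"
  shows "\<exists>b. (\<Sum>e\<in>exps S. 2 * weight_table e (level S e div P)) \<le> 2 * column_weight b
    \<and> 2 * P\<^sup>2 * b \<le> S \<and> S < 2 * P\<^sup>2 * (b + 1) + 4 * P"
proof -
  define d where "d = S div P"
  define \<rho> where "\<rho> = d mod 2"
  define Y where "Y = d div 2"
  have \<rho>: "\<rho> = 0 \<or> \<rho> = 1" unfolding \<rho>_def by auto
  have d: "d = \<rho> + 2 * Y" unfolding \<rho>_def Y_def by simp
  have "Y \<ge> 0" unfolding Y_def d_def using assms P_pos by (simp add: pos_imp_zdiv_nonneg_iff)
  have lev: "level S \<rho> = Y" "level S (\<rho> + 2) = Y - 1" "level S (\<rho> + 4) = Y - 2"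
    unfolding level_def d_def [symmetric] d by simp_all
  obtain b where b: "weight_table \<rho> (Y div P) + weight_table (\<rho> + 2) ((Y - 1) div P)
      + weight_table (\<rho> + 4) ((Y - 2) div P) \<le> column_weight b" "P * b \<le> Y" "Y - 2 < P * (b + 1)"
    using column_bound[OF _ \<open>Y \<ge> 0\<close> \<rho>, of P] P_ge by auto
  have "(\<Sum>e\<in>exps S. 2 * weight_table e (level S e div P)) = 2 * (weight_table \<rho> (Y div P)
      + weight_table (\<rho> + 2) ((Y - 1) div P) + weight_table (\<rho> + 4) ((Y - 2) div P))"
    unfolding exps_def d_def [symmetric] \<rho>_def [symmetric] by (simp add: lev)
  hence wt: "(\<Sum>e\<in>exps S. 2 * weight_table e (level S e div P)) \<le> 2 * column_weight b"
    using mult_le_mono2[OF b(1), of 2] by (simp only:)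
  have S: "S = P * d + S mod P" "0 \<le> S mod P" "S mod P < P"
    unfolding d_def using P_pos by simp_all
  have "P * (2 * (P * b)) \<le> P * d" using b(2) \<rho> P_pos d by (intro mult_left_mono) auto
  moreover have "P * (2 * (P * b)) = 2 * P\<^sup>2 * b" by (simp add: power2_eq_square)
  ultimately have lo: "2 * P\<^sup>2 * b \<le> S" using S by linarith
  have "P * d \<le> P * (2 * (P * (b + 1)) + 3)"
    using b(3) \<rho> P_pos d by (intro mult_left_mono) auto
  moreover have "P * (2 * (P * (b + 1)) + 3) = 2 * P\<^sup>2 * (b + 1) + 3 * P"
    by (simp add: power2_eq_square algebra_simps)
  ultimately have hi: "S < 2 * P\<^sup>2 * (b + 1) + 4 * P" using S by linarith
  show ?thesis using wt lo hi by blast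
qed

lemma sum_column_weight_le:
  assumes "finite X" "c \<in> {0, 1, 2, 3}" "c \<notin> X"
  shows "(\<Sum>x\<in>X. column_weight x) \<le> 96"
proof -
  have "(\<Sum>x\<in>X. column_weight x) = (\<Sum>x\<in>X \<inter> {0..5}. column_weight x)"
    using assms(1) by (intro sum.mono_neutral_right) (auto simp: column_weight_def)
  also have "\<dots> \<le> (\<Sum>x\<in>{0, 1, 2, 3, 4, 5} - {c}. column_weight x)"
    using assms(3) by (intro sum_mono2) auto
  also have "\<dots> \<le> 96"
    using assms(2) by (auto simp: column_weight_def insert_Diff_if)
  finally show ?thesis .
qed

text \<open>
  The integers \<open>S\<close> congruent to \<open>n\<close> that are sums of two positions occupy different columns, and not all of the four
  columns \<open>0, 1, 2, 3\<close>, because \<open>3 m > 8 p\<^sup>2 + 4 p\<close>. As the six column weights add up to 114 and these four are at least 18,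
  the total is at most \<open>2 (114 - 18) = 192\<close>.
\<close>

lemma card_rep_pairs_le_192: "card (rep_pairs n) \<le> 192"
proof -
  have "\<forall>S\<in>pair_sums n. \<exists>b. (\<Sum>e\<in>exps S. 2 * weight_table e (level S e div P)) \<le> 2 * column_weight b
    \<and> 2 * P\<^sup>2 * b \<le> S \<and> S < 2 * P\<^sup>2 * (b + 1) + 4 * P"
    using column_of_sum pair_sums_nonneg by blast
  from bchoice[OF this] obtain col where "\<forall>S\<in>pair_sums n.
      (\<Sum>e\<in>exps S. 2 * weight_table e (level S e div P)) \<le> 2 * column_weight (col S)
      \<and> 2 * P\<^sup>2 * col S \<le> S \<and> S < 2 * P\<^sup>2 * (col S + 1) + 4 * P" ..
  hence col: "\<And>S. S \<in> pair_sums n \<Longrightarrow>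
      (\<Sum>e\<in>exps S. 2 * weight_table e (level S e div P)) \<le> 2 * column_weight (col S)"
    and lo: "\<And>S. S \<in> pair_sums n \<Longrightarrow> 2 * P\<^sup>2 * col S \<le> S"
    and hi: "\<And>S. S \<in> pair_sums n \<Longrightarrow> S < 2 * P\<^sup>2 * (col S + 1) + 4 * P"
    by blast+
  have gap: "S + M \<le> S'" if "S \<in> pair_sums n" "S' \<in> pair_sums n" "S < S'" for S S'
  proof -
    have "[S' = S] (mod M)" using pair_sums_cong[OF that(1)] pair_sums_cong[OF that(2)] by (meson cong_sym cong_trans)
    hence "M dvd S' - S" by (simp add: cong_iff_dvd_diff)
    hence "M \<le> S' - S" using that(3) by (intro zdvd_imp_le) auto
    thus ?thesis by simp
  qed
  \<comment> \<open>Otherwise \<open>S' - S\<close> would be below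
    \<open>2 * P\<^sup>2 + 4 * P\<close>, hence below \<open>M\<close>, although congruent distinct
    sums differ by at least \<open>M\<close>.\<close>
  have mono: "col S < col S'" if "S \<in> pair_sums n" "S' \<in> pair_sums n" "S < S'" for S S'
  proof (rule ccontr)
    assume "\<not> col S < col S'"
    hence "2 * P\<^sup>2 * (col S' + 1) \<le> 2 * P\<^sup>2 * (col S + 1)" by (intro mult_left_mono) auto
    hence "S' < 2 * P\<^sup>2 * col S + 2 * P\<^sup>2 + 4 * P" using hi[OF that(2)] by (simp add: algebra_simps)
    thus False using lo[OF that(1)] gap[OF that] M_gt2 by linarith
  qed
  have inj: "inj_on col (pair_sums n)"
    by (rule linorder_inj_onI') (use mono in \<open>simp add: less_imp_neq\<close>)
  \<comment> \<open>Sums in all of the columns 0 to 3 would span at least \<open>3 * M\<close>,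
    while column 3 ends at \<open>8 * P\<^sup>2 + 4 * P\<close>.\<close>
  obtain c where c: "c \<in> {0, 1, 2, 3}" "c \<notin> col ` pair_sums n"
  proof (rule ccontr)
    assume "\<not> thesis"
    hence "0 \<in> col ` pair_sums n" "1 \<in> col ` pair_sums n" "2 \<in> col ` pair_sums n" "3 \<in> col ` pair_sums n"
      using that by blast+
    then obtain S0 S1 S2 S3 where S: "S0 \<in> pair_sums n" "S1 \<in> pair_sums n" "S2 \<in> pair_sums n" "S3 \<in> pair_sums n"
      and cs: "col S0 = 0" "col S1 = 1" "col S2 = 2" "col S3 = 3" by (elim imageE) simp
    have less: "S < S'" if "S \<in> pair_sums n" "S' \<in> pair_sums n" "col S < col S'" for S S'
      using mono[of S' S] that by (cases S S' rule: linorder_cases) auto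
    have "S0 < S1" "S1 < S2" "S2 < S3" using less S cs by simp_all
    hence "S0 + M \<le> S1" "S1 + M \<le> S2" "S2 + M \<le> S3" using gap S by blast+
    hence "S0 + 3 * M \<le> S3" by linarith
    moreover have "S3 < 8 * P\<^sup>2 + 4 * P" using hi[OF S(4)] cs(4) by simp
    ultimately show False using pair_sums_nonneg[OF S(1)] M_gt by linarith
  qed
  have "card (rep_pairs n) \<le> (\<Sum>S\<in>pair_sums n. \<Sum>e\<in>exps S. 2 * weight_table e (level S e div P))"
    by (rule card_rep_pairs_le)
  also have "\<dots> \<le> (\<Sum>S\<in>pair_sums n. 2 * column_weight (col S))" by (intro sum_mono col)
  also have "\<dots> = 2 * (\<Sum>x\<in>col ` pair_sums n. column_weight x)"
    by (simp add: sum.reindex[OF inj] sum_distrib_left)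
  also have "\<dots> \<le> 2 * 96"
    using sum_column_weight_le[OF _ c] finite_pair_sums by (intro mult_left_mono) auto
  finally show ?thesis by simp
qed

section \<open>Every residue class is represented\<close>

lemma part_cover:
  assumes "0 \<le> e" "e \<le> 2" and "(a, b) \<in> {(0, 0), (1, 2), (2, 1)}"
  shows "\<exists>x\<in>set (part a). \<exists>y\<in>set (part b). x + y = e"
proof -
  have "e = 0 \<or> e = 1 \<or> e = 2" using assms by linarith
  thus ?thesis using assms(3) unfolding part_def by auto
qed

lemma rep_count_pos: "1 \<le> rep_count m ruzsa_set n"
proof -
  \<comment> \<open>Subtracting one horizontal and one vertical unit in advance keeps the required
    shift sums nonnegative after a carry has been deducted.\<close>
  define S1 where "S1 = (n - P - 2 * P\<^sup>2) mod M"
  have S1: "0 \<le> S1" "S1 < 4 * P\<^sup>2" using M_pos M_le pos_mod_bound[OF M_pos, of "n - P - 2 * P\<^sup>2"]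
      pos_mod_sign[OF M_pos, of "n - P - 2 * P\<^sup>2"]
    unfolding S1_def by linarith+
  have cong: "[S1 + P + 2 * P\<^sup>2 = n] (mod M)"
  proof -
    have "[S1 + (P + 2 * P\<^sup>2) = (n - P - 2 * P\<^sup>2) + (P + 2 * P\<^sup>2)] (mod M)"
      unfolding S1_def cong_def by (rule mod_add_left_eq)
    thus ?thesis by (simp add: add.assoc)
  qed
  \<comment> \<open>Mixed radix digits of \<open>S1\<close>: \<open>(a, b)\<close> is the target
    point modulo \<open>p\<close>, while \<open>e\<close> and \<open>B\<close> are block offsets.
    Both are 0 or 1, for \<open>B\<close> because \<open>S1 < 4 * P\<^sup>2\<close>.\<close>
  define a where "a = S1 mod P"
  define d where "d = S1 div P"
  define e where "e = d mod 2"
  define y where "y = d div 2"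
  define b where "b = y mod P"
  define B where "B = y div P"
  have S1_eq: "S1 = a + P * (e + 2 * (b + P * B))"
    unfolding a_def d_def e_def y_def b_def B_def by simp
  have a: "0 \<le> a" "a < P" and b: "0 \<le> b" "b < P" and e: "0 \<le> e" "e \<le> 1"
    unfolding a_def b_def e_def using P_pos by auto
  have "P * (2 * (P * B)) \<le> S1" unfolding S1_eq using a b e P_pos by (simp add: algebra_simps)
  hence "P * P * (2 * B) < P * P * 4" using S1(2) by (simp add: power2_eq_square algebra_simps)
  hence "2 * B < 4" using P_pos by (simp only: mult_less_cancel_left_pos mult_pos_pos)
  hence B1: "B \<le> 1" by simp
  have B0: "0 \<le> B" unfolding B_def y_def d_def using S1(1) P_pos by (simp add: pos_imp_zdiv_nonneg_iff)
  have finish: ?thesis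
    if ij: "i < 3" "j < 3" and uu: "(u, u') \<in> parabola_sols P (coef i) (coef j) a b"
      and cover: "\<And>e. 0 \<le> e \<Longrightarrow> e \<le> 2 \<Longrightarrow> \<exists>x\<in>set (part i). \<exists>y\<in>set (part j). x + y = e"
        "\<And>e. 0 \<le> e \<Longrightarrow> e \<le> 2 \<Longrightarrow> \<exists>x\<in>set (part (swap12 i)). \<exists>y\<in>set (part (swap12 j)). x + y = e"
    for i j u u'
  proof -
    define v where "v = height i u"
    define v' where "v' = height j u'"
    have u: "u \<in> {0..<P}" "u' \<in> {0..<P}" "[u + u' = a] (mod P)"
      "[coef i * u\<^sup>2 + coef j * u'\<^sup>2 = b] (mod P)" using uu unfolding parabola_sols_def by auto
    define \<alpha> where "\<alpha> = (u + u') div P"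
    define \<beta> where "\<beta> = (v + v') div P"
    have \<alpha>: "\<alpha> = 0 \<or> \<alpha> = 1" unfolding \<alpha>_def using u by (intro div_carry) auto
    have \<beta>: "\<beta> = 0 \<or> \<beta> = 1" unfolding \<beta>_def v_def v'_def by (intro div_carry height_range)
    have "(u + u') mod P = a" using u(3) a by (simp add: cong_def)
    hence ueq: "u + u' = a + P * \<alpha>" unfolding \<alpha>_def by (metis add.commute mult_div_mod_eq)
    have "(v + v') mod P = b" using u(4) b unfolding v_def v'_def height_def by (simp add: cong_def mod_add_eq)
    hence veq: "v + v' = b + P * \<beta>" unfolding \<beta>_def by (metis add.commute mult_div_mod_eq)
    \<comment> \<open>As \<open>e\<close> and \<alpha> are 0 or 1, only the shift sums 0, 1, 2 are
      required, which is what the lists in \<open>part\<close> are chosen to provide.\<close>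
    obtain r r' where r: "r \<in> set (part i)" "r' \<in> set (part j)" "r + r' = e + 1 - \<alpha>"
      using cover(1)[of "e + 1 - \<alpha>"] e \<alpha> by auto
    obtain t t' where t: "t \<in> set (part (swap12 i))" "t' \<in> set (part (swap12 j))" "t + t' = B + 1 - \<beta>"
      using cover(2)[of "B + 1 - \<beta>"] B0 B1 \<beta> by auto
    define x where "x = (i, u, r, t)"
    define x' where "x' = (j, u', r', t')"
    have pts: "x \<in> points" "x' \<in> points" unfolding x_def x'_def points_def using ij u r t by auto
    have "pos x + pos x' = (u + u') + P * (r + r') + 2 * P * ((v + v') + P * (t + t'))"
      unfolding x_def x'_def v_def v'_def by (simp add: algebra_simps)
    also have "\<dots> = S1 + P + 2 * P\<^sup>2"
      unfolding ueq veq r(3) t(3) S1_eq by (simp add: power2_eq_square algebra_simps)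
    finally have sum: "[pos x mod M + pos x' mod M = n] (mod M)"
      using cong by (simp add: cong_def mod_add_eq)
    have "(pos x mod M, pos x' mod M) \<in> {(a, a') \<in> ruzsa_set \<times> ruzsa_set. [a + a' = n] (mod M)}"
      using pts[THEN imageI, of "\<lambda>x. pos x mod M"] sum unfolding ruzsa_set_def by blast
    moreover have "finite {(a, a') \<in> ruzsa_set \<times> ruzsa_set. [a + a' = n] (mod M)}"
      by (rule finite_subset[of _ "ruzsa_set \<times> ruzsa_set"])
         (auto simp: ruzsa_set_def finite_points)
    ultimately have "0 < rep_count m ruzsa_set n" unfolding rep_count_def card_gt_0_iff by blast
    thus ?thesis by simp
  qed
  have sw: "swap12 0 = 0" "swap12 1 = 2" "swap12 2 = 1" by (simp_all add: swap12_def)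
  have cf: "coef 0 = 2 * s" "coef 1 = s * (s + 1)" "coef 2 = s + 1" by (simp_all add: coef_def)
  have "2 < p" using p_ge by simp
  from parabola_cover[OF prime this nonres s_dvd(1), of a b]
  consider (c) u u' where "(u, u') \<in> parabola_sols P (coef 0) (coef 0) a b"
    | (kl) u u' where "(u, u') \<in> parabola_sols P (coef 1) (coef 2) a b"
    unfolding cf by (metis equals0I surj_pair)
  thus ?thesis
  proof cases
    case c
    show ?thesis by (rule finish[OF _ _ c]) (simp_all add: sw part_cover)
  next
    case kl
    show ?thesis by (rule finish[OF _ _ kl]) (unfold sw, simp, simp, (rule part_cover; simp)+)
  qed
qed

lemma ruzsa_bounded_ruzsa_set: "ruzsa_bounded m 192 ruzsa_set"
  unfolding ruzsa_bounded_def
proof (intro conjI allI)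
  show "ruzsa_set \<subseteq> {0..<M}" unfolding ruzsa_set_def using M_pos by auto
  show "1 \<le> rep_count m ruzsa_set n" for n by (rule rep_count_pos)
  show "rep_count m ruzsa_set n \<le> 192" for n
    using rep_count_le_card_rep_pairs card_rep_pairs_le_192 by (rule order_trans)
qed

end

subsection \<open>Additive energy\<close>

lemma sum_card_fibre:
  assumes "finite S" "finite T" "f ` S \<subseteq> T"
  shows "(\<Sum>y\<in>T. card {x \<in> S. f x = y}) = card S"
  unfolding card_eq_sum by (rule sum.group[OF assms])

text \<open>Sort the pairs with equal image by that image: each fibre contributes its
  square.\<close>

lemma sum_card_fibre_squared:
  assumes "finite S" "finite T" "f ` S \<subseteq> T"
  shows "(\<Sum>y\<in>T. (card {x \<in> S. f x = y})\<^sup>2) = card {(x, x') \<in> S \<times> S. f x = f x'}"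
proof -
  define D where "D = {(x, x') \<in> S \<times> S. f x = f x'}"
  have "D \<subseteq> S \<times> S" unfolding D_def by auto
  hence "finite D" using assms(1) by (auto intro: finite_subset)
  hence "card D = (\<Sum>y\<in>T. card {z \<in> D. f (fst z) = y})"
    using assms unfolding D_def by (intro sum_card_fibre [symmetric]) auto
  also have "\<dots> = (\<Sum>y\<in>T. card ({x \<in> S. f x = y} \<times> {x \<in> S. f x = y}))"
    unfolding D_def by (intro sum.cong refl arg_cong[where f = card]) auto
  finally show ?thesis unfolding D_def by (simp add: power2_eq_square card_cartesian_product)
qed

context
  fixes m :: nat and A :: "int set"
  assumes m: "m > 0" and A: "A \<subseteq> {0..<int m}"
begin

definition diff_count :: "int \<Rightarrow> nat" where
  "diff_count d = card {(a, a') \<in> A \<times> A. (a - a') mod int m = d}"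

lemma finite_A: "finite A"
  using A by (rule finite_subset) simp

lemma rep_count_eq: "n \<in> {0..<int m} \<Longrightarrow> rep_count m A n = card {z \<in> A \<times> A. (fst z + snd z) mod int m = n}"
  unfolding rep_count_def by (rule arg_cong[where f = card]) (auto simp: cong_def)

lemma diff_count_eq: "diff_count d = card {z \<in> A \<times> A. (fst z - snd z) mod int m = d}"
  unfolding diff_count_def by (rule arg_cong[where f = card]) auto

lemma sum_rep_count: "(\<Sum>n\<in>{0..<int m}. rep_count m A n) = (card A)\<^sup>2"
proof -
  have "(\<Sum>n\<in>{0..<int m}. card {z \<in> A \<times> A. (fst z + snd z) mod int m = n}) = card (A \<times> A)"
    using m finite_A by (intro sum_card_fibre) auto
  thus ?thesis by (simp add: rep_count_eq power2_eq_square card_cartesian_product)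
qed

lemma sum_diff_count: "(\<Sum>d\<in>{0..<int m}. diff_count d) = (card A)\<^sup>2"
proof -
  have "(\<Sum>d\<in>{0..<int m}. card {z \<in> A \<times> A. (fst z - snd z) mod int m = d}) = card (A \<times> A)"
    using m finite_A by (intro sum_card_fibre) auto
  thus ?thesis by (simp add: diff_count_eq power2_eq_square card_cartesian_product)
qed

lemma diff_count_0: "diff_count 0 = card A"
proof -
  have "{(a, a') \<in> A \<times> A. (a - a') mod int m = 0} = (\<lambda>a. (a, a)) ` A"
  proof (intro equalityI subsetI)
    fix z assume "z \<in> {(a, a') \<in> A \<times> A. (a - a') mod int m = 0}"
    then obtain a a' where z: "z = (a, a')" "a \<in> A" "a' \<in> A" "(a - a') mod int m = 0" by auto
    hence "a mod int m = a' mod int m" by (simp add: mod_eq_dvd_iff mod_eq_0_iff_dvd)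
    moreover have "a \<in> {0..<int m}" "a' \<in> {0..<int m}" using A z by auto
    ultimately show "z \<in> (\<lambda>a. (a, a)) ` A" using z by simp
  qed auto
  thus ?thesis unfolding diff_count_def by (simp add: card_image inj_on_def)
qed

lemma add_mod_eq_iff_diff_mod_eq:
  "(a + b) mod M = (c + d) mod M \<longleftrightarrow> (a - c) mod M = (d - b) mod (M :: int)"
proof -
  have "a + b - (c + d) = a - c - (d - b)" by simp
  thus ?thesis unfolding mod_eq_dvd_iff by (simp only:)
qed

text \<open>Both sides are the additive energy of \<open>A\<close>: a + b = c + d is the same
  equation as a - c = d - b.\<close>

lemma sum_rep_count_squared:
  "(\<Sum>n\<in>{0..<int m}. (rep_count m A n)\<^sup>2) = (\<Sum>d\<in>{0..<int m}. (diff_count d)\<^sup>2)"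
proof -
  let ?M = "int m"
  have "(\<Sum>n\<in>{0..<?M}. (card {z \<in> A \<times> A. (fst z + snd z) mod ?M = n})\<^sup>2)
      = card {(z, w) \<in> (A \<times> A) \<times> (A \<times> A). (fst z + snd z) mod ?M = (fst w + snd w) mod ?M}"
    using m finite_A by (intro sum_card_fibre_squared) auto
  also have "\<dots> = card {(z, w) \<in> (A \<times> A) \<times> (A \<times> A). (fst z - snd z) mod ?M = (fst w - snd w) mod ?M}"
    by (rule bij_betw_same_card[of "\<lambda>((a, b), (c, d)). ((a, c), (d, b))"],
        rule bij_betw_byWitness[where f' = "\<lambda>((a, c), (d, b)). ((a, b), (c, d))"])
       (auto simp: add_mod_eq_iff_diff_mod_eq)
  also have "\<dots> = (\<Sum>d\<in>{0..<?M}. (card {z \<in> A \<times> A. (fst z - snd z) mod ?M = d})\<^sup>2)"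
    using m finite_A by (intro sum_card_fibre_squared [symmetric]) auto
  finally show ?thesis by (simp add: rep_count_eq diff_count_eq)
qed

text \<open>The difference 0 contributes the square of \<open>card A\<close>; Cauchy-Schwarz handles
  the remaining differences, whose counts add up to
  \<open>(card A)\<^sup>2 - card A\<close>.\<close>

lemma energy_lower:
  "real m * (real (card A))\<^sup>2 + ((real (card A))\<^sup>2 - real (card A))\<^sup>2
     \<le> real m * (\<Sum>n\<in>{0..<int m}. (real (rep_count m A n))\<^sup>2)"
proof -
  let ?k = "real (card A)"
  let ?D = "{0<..<int m}"
  have D: "{0..<int m} = insert 0 ?D" using m by auto
  have "?k\<^sup>2 = (\<Sum>d\<in>{0..<int m}. real (diff_count d))"
    using arg_cong[OF sum_diff_count, of real] by (simp only: of_nat_power of_nat_sum)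
  hence 1: "(\<Sum>d\<in>?D. real (diff_count d)) = ?k\<^sup>2 - ?k"
    unfolding D by (simp add: diff_count_0)
  have "(\<Sum>d\<in>?D. real (diff_count d))\<^sup>2 \<le> real (card ?D) * (\<Sum>d\<in>?D. (real (diff_count d))\<^sup>2)"
    using Cauchy_Schwarz_ineq_sum[of "\<lambda>_. 1" "\<lambda>d. real (diff_count d)" ?D] by simp
  also have "\<dots> \<le> real m * (\<Sum>d\<in>?D. (real (diff_count d))\<^sup>2)"
    by (intro mult_right_mono sum_nonneg) auto
  finally have 2: "(?k\<^sup>2 - ?k)\<^sup>2 \<le> real m * (\<Sum>d\<in>?D. (real (diff_count d))\<^sup>2)" unfolding 1 .
  have "(\<Sum>n\<in>{0..<int m}. (real (rep_count m A n))\<^sup>2) = (\<Sum>d\<in>{0..<int m}. (real (diff_count d))\<^sup>2)"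
    using arg_cong[OF sum_rep_count_squared, of real] by (simp only: of_nat_power of_nat_sum)
  also have "\<dots> = ?k\<^sup>2 + (\<Sum>d\<in>?D. (real (diff_count d))\<^sup>2)"
    unfolding D by (simp add: diff_count_0)
  finally show ?thesis using 2 by (simp add: algebra_simps)
qed

lemma card_le_of_rep_count_bounds:
  assumes "\<And>n. 1 \<le> rep_count m A n" "\<And>n. rep_count m A n \<le> 192" and large: "m \<ge> 30000000"
  shows "(card A)\<^sup>2 \<le> 191 * m"
proof (rule ccontr)
  assume "\<not> (card A)\<^sup>2 \<le> 191 * m"
  define k where "k = real (card A)"
  define M where "M = real m"
  have M: "M \<ge> 30000000" using large unfolding M_def by simp
  have k0: "k \<ge> 0" unfolding k_def by simp
  have "191 * m \<le> (card A)\<^sup>2" using \<open>\<not> _\<close> by simp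
  hence "real (191 * m) \<le> real ((card A)\<^sup>2)" by (rule of_nat_mono)
  hence k1: "191 * M \<le> k\<^sup>2" unfolding k_def M_def by simp
  have sum: "(\<Sum>n\<in>{0..<int m}. real (rep_count m A n)) = k\<^sup>2"
    using arg_cong[OF sum_rep_count, of real] unfolding k_def by (simp only: of_nat_power of_nat_sum)
  have "(\<Sum>n\<in>{0..<int m}. real (rep_count m A n)) \<le> (\<Sum>n\<in>{0..<int m}. 192)"
    using assms(2) by (intro sum_mono) simp
  hence k2: "k\<^sup>2 \<le> 192 * M" unfolding sum M_def by simp
  have "(\<Sum>n\<in>{0..<int m}. (real (rep_count m A n))\<^sup>2)
      \<le> (\<Sum>n\<in>{0..<int m}. 193 * real (rep_count m A n) - 192)"
  proof (rule sum_mono)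
    fix n
    have "0 \<le> (real (rep_count m A n) - 1) * (192 - real (rep_count m A n))"
      using assms(1,2)[of n] by (intro mult_nonneg_nonneg) auto
    thus "(real (rep_count m A n))\<^sup>2 \<le> 193 * real (rep_count m A n) - 192"
      by (simp add: power2_eq_square algebra_simps)
  qed
  also have "\<dots> = 193 * k\<^sup>2 - 192 * M"
    unfolding M_def by (simp add: sum_subtractf sum_distrib_left [symmetric] sum)
  finally have "M * (\<Sum>n\<in>{0..<int m}. (real (rep_count m A n))\<^sup>2) \<le> M * (193 * k\<^sup>2 - 192 * M)"
    using M by (intro mult_left_mono) auto
  hence 1: "M * k\<^sup>2 + (k\<^sup>2 - k)\<^sup>2 \<le> M * (193 * k\<^sup>2 - 192 * M)"
    using energy_lower unfolding k_def M_def by linarith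
  \<comment> \<open>With X = k^2 this says X^2 - 192 M X + 191 M^2 is nonnegative, whereas the
    energy estimate has 192 M^2 in that place, up to an error of 2 k X. The difference leaves M^2
    bounded by that error.\<close>
  have 2: "0 \<le> (k\<^sup>2 - 191 * M) * (k\<^sup>2 - M)"
    using k1 M by (intro mult_nonneg_nonneg) auto
  define X where "X = k * k"
  have "M * X + (X * X - 2 * (k * X) + X) \<le> 193 * (M * X) - 192 * (M * M)"
    using 1 unfolding X_def by (simp add: power2_eq_square algebra_simps)
  moreover have "0 \<le> X * X - 192 * (M * X) + 191 * (M * M)"
    using 2 unfolding X_def by (simp add: power2_eq_square algebra_simps)
  moreover have "0 \<le> X" unfolding X_def by simp
  ultimately have "M * M \<le> 2 * (k * X)" by linarith
  hence "M * M \<le> 2 * k * k\<^sup>2" unfolding X_def by (simp add: power2_eq_square)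
  also have "\<dots> \<le> 2 * k * (192 * M)" using k2 k0 by (intro mult_left_mono) auto
  \<comment> \<open>Together with k^2 at most 192 M this forces M to be at most 384^2 * 192 =
    28311552, hence the threshold 30000000.\<close>
  finally have "M \<le> 384 * k" using M by simp
  hence "M\<^sup>2 \<le> (384 * k)\<^sup>2" using M by (intro power_mono) auto
  also have "\<dots> = 147456 * k\<^sup>2" by (simp add: power2_eq_square)
  also have "\<dots> \<le> 147456 * (192 * M)" using k2 by simp
  finally show False using M by (simp add: power2_eq_square)
qed

end

subsection \<open>Upper bound for the Ruzsa number\<close>

text \<open>Take a prime p between M and 1.22 M, where M is half the square root of m rounded down.
  Then p exceeds half that root, so m is at most 4 p^2; and p is at most 0.61 times that root, so 8
  p^2 is at most 2.9768 m.\<close>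

lemma ruzsa_bounded_192_exists:
  "\<exists>m0. \<forall>m\<ge>m0. \<exists>A. ruzsa_bounded m 192 A"
proof -
  obtain M0 where M0: "\<And>M. M \<ge> M0 \<Longrightarrow> \<exists>p. prime p \<and> M < p \<and> 100 * p \<le> 122 * (M :: nat)"
    using eventually_prime_between unfolding eventually_sequentially by blast
  have "\<exists>A. ruzsa_bounded m 192 A" if m: "m \<ge> 4 * (M0 + 100)\<^sup>2" for m
  proof -
    define q where "q = sqrt (real m)"
    have q2: "q\<^sup>2 = real m" unfolding q_def by simp
    have "real (4 * (M0 + 100)\<^sup>2) \<le> real m" using m by (rule of_nat_mono)
    hence "(2 * (real M0 + 100))\<^sup>2 \<le> real m" by (simp only: power_mult_distrib) simp
    hence "2 * (real M0 + 100) \<le> q" unfolding q_def by (rule real_le_rsqrt)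
    hence q: "2 * real M0 + 200 \<le> q" by simp
    define M where "M = nat \<lfloor>q / 2\<rfloor>"
    have M: "real M \<le> q / 2" "q / 2 < real M + 1" using q unfolding M_def by linarith+
    have M_ge: "M \<ge> M0 + 99" using M(2) q by linarith
    hence "M \<ge> M0" by simp
    then obtain p where p: "prime p" "M < p" "100 * p \<le> 122 * M" using M0 by blast
    have p_lo: "q / 2 < real p" using M(2) p(2) by linarith
    have p_hi: "real p \<le> 61 / 100 * q" using M(1) p(3) by linarith
    have "q\<^sup>2 \<le> (2 * real p)\<^sup>2" using p_lo q by (intro power_mono) auto
    hence "real m \<le> real (4 * p\<^sup>2)" unfolding q2 by (simp add: power_mult_distrib)
    hence m_le: "m \<le> 4 * p\<^sup>2" by (simp only: of_nat_le_iff)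
    have "(real p)\<^sup>2 \<le> (61 / 100 * q)\<^sup>2" using p_hi by (intro power_mono) auto
    also have "\<dots> = 3721 / 10000 * q\<^sup>2" by (simp add: power2_eq_square)
    finally have "8 * (real p)\<^sup>2 + 4 * real p \<le> 29768 / 10000 * q\<^sup>2 + 244 / 100 * q"
      using p_hi by linarith
    \<comment> \<open>Absorbs the linear term 2.44 q into the gap between 2.9768 and 3.\<close>
    moreover have "200 * q \<le> q\<^sup>2" using q unfolding power2_eq_square by (intro mult_right_mono) auto
    ultimately have "8 * (real p)\<^sup>2 + 4 * real p < 3 * q\<^sup>2" using q by linarith
    hence "real (8 * p\<^sup>2 + 4 * p) < real (3 * m)" unfolding q2 by simp
    hence m_gt: "8 * p\<^sup>2 + 4 * p < 3 * m" by (simp only: of_nat_less_iff)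
    have "9 < p" using p(2) M_ge by linarith
    with p(1) obtain s where "\<not> QuadRes (int p) s" "\<not> int p dvd s + 1" "\<not> int p dvd s + 3"
      "\<not> int p dvd 3 * s + 1" by (rule exists_nonresidue)
    then interpret ruzsa_construction p m s
      using p(1) \<open>9 < p\<close> m_le m_gt by unfold_locales auto
    show ?thesis using ruzsa_bounded_ruzsa_set by blast
  qed
  thus ?thesis by blast
qed

theorem corollary1:
  "\<exists>m0::nat. \<forall>m\<ge>m0. \<forall>A\<in>ruzsa_sets m. real (card A) \<le> sqrt (191 * real m)"
proof -
  obtain m0 where m0: "\<And>m. m \<ge> m0 \<Longrightarrow> \<exists>A. ruzsa_bounded m 192 A"
    using ruzsa_bounded_192_exists by blast
  have "real (card A) \<le> sqrt (191 * real m)"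
    if m: "m \<ge> max m0 30000000" and A: "A \<in> ruzsa_sets m" for m A
  proof -
    \<comment> \<open>By minimality, so every set in \<open>ruzsa_sets m\<close> inherits the bound
      192.\<close>
    have "ruzsa_number m \<le> 192"
      unfolding ruzsa_number_def using m0[of m] m by (intro Least_le) simp
    moreover have bounded: "ruzsa_bounded m (ruzsa_number m) A"
      using A unfolding ruzsa_sets_def by simp
    ultimately have "(card A)\<^sup>2 \<le> 191 * m"
      using m unfolding ruzsa_bounded_def
      by (intro card_le_of_rep_count_bounds) (auto intro: order_trans)
    hence "real ((card A)\<^sup>2) \<le> real (191 * m)" by (rule of_nat_mono)
    thus ?thesis by (intro real_le_rsqrt) simp
  qed
  thus ?thesis by blast
qed

end
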